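(* Fix the data $z$. Assume: (1) $\theta\mapsto \ell(\theta)$ is finite everywhere on $\mathbb{R}^d$, convex, and twice continuously differentiable; (2) for all $\delta\in\Delta$, $\theta\mapsto P(\theta\vert\delta)$ is convex, lower semi-continuous, not identically $+\infty$, and admits a sub-gradient $g(\theta\vert\delta)$ at $\theta$, for all $\theta\in\mathbb{R}^d_\delta$. Assume moreover that there are finite constants $L_1,L_2\ge0$ and, for each $\delta\in\Delta$, a finite constant $c(\delta)$ such that $$\|\nabla\ell(\theta_1)-\nabla\ell(\theta_2)\|\le L_1\|\theta_1-\theta_2\|,\quad \theta_1,\theta_2\in\mathbb{R}^d,$$ $$\|\delta\cdot\nabla\ell(\theta)\|^2\le 2L_2\,\ell(\theta),\quad \delta\in\Delta,\ \theta\in\mathbb{R}^d_\delta,$$ $$\|\delta\cdot g(\theta\vert\delta)\|^2\le c(\delta)+2L_2P(\theta\vert\delta),\quad \delta\in\Delta,\ \theta\in\mathbb{R}^d_\delta.$$ Suppose $\gamma>0$ is such that $4\gamma\max(L_1,L_2)\le1$. Then $\check\Pi_\gamma(\cdot\vert z)$ is well-defined and $$\mathsf{d}_\beta\left(\check\Pi_\gamma(\cdot\vert z),\check\Pi(\cdot\vert z)\right)\le\sqrt{\gamma d}+2\left(1-e^{-\varrho_\gamma(z)}\right),$$ where $$\varrho_\gamma(z)\le 3\gamma\left[\frac12\max_{\delta\in\Delta}c(\delta)+d(L_1+2L_2)+L_2\mathcal{R}(z)\right],$$ with $\mathcal{R}(z)=\max_{\delta\in\Delta}\inf_{\theta\i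n\mathbb{R}^d}\left[\ell(\theta_\delta)+P(\theta_\delta\vert\delta)\right]\le\max_{\delta\in\Delta}\left[\ell(0)+P(0\vert\delta)\right]$.
   Context: Let $d\ge1$ be an integer and $\Delta=\{0,1\}^d$. For $\theta,\vartheta\in\mathbb{R}^d$, $\theta\cdot\vartheta$ is the component-wise product; for $\delta\in\Delta$, $\theta_\delta=\theta\cdot\delta$ and $\mathbb{R}^d_\delta=\{\theta\in\mathbb{R}^d:\theta_j=0 \text{ whenever } \delta_j=0\}$. $\|\cdot\|$ and $\langle\cdot,\cdot\rangle$ are the Euclidean norm and inner product, and $\|\cdot\|_0$ is the number of non-zero components. The measure $\mu_\delta(d\theta)=\prod_{j=1}^d\nu_{\delta_j}(d\theta_j)$, where $\nu_0$ is the Dirac mass at $0$ and $\nu_1$ is Lebesgue measure on $\mathbb{R}$. Conventions: $e^{-\infty}=0$, $0\times\infty=0$. Model: $z$ is fixed data with likelihood $f_\theta(z)$, $\theta\in\mathbb{R}^d$; $\ell(\theta)=-\log f_\theta(z)$. $\{\pi_\delta,\delta\in\Delta\}$ is a probability distribution on $\Delta$, and $p$ is a positive probability density on $\mathbb{R}$. Define $P(\theta\vert\delta)=-\sum_{j:\delta_j=1}\log p(\theta_j)$ if $\theta\in\mathbb{R}^d_\delta$ and $P(\theta\vert\delta)=+\infty$ otherwise, and $h(\theta\vert\delta)=\ell(\theta)+P(\theta\vert\delta)$. Posterior distribution on $\Delta\times\mathbb{R}^d$: $\check\Pi(\delta,d\theta\vert z)\propto \pi_\delta e^{-h(\theta\vert\delta)}\mu_\delta(d\theta)$.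 For $\gamma>0$ let $$h_\gamma(\theta\vert\delta)=\min_{u\in\mathbb{R}^d}\left[\ell(\theta)+\langle\nabla\ell(\theta),u-\theta\rangle+P(u\vert\delta)+\frac{1}{2\gamma}\|u-\theta\|^2\right],$$ and let $\check\Pi_\gamma(\delta,d\theta\vert z)\propto\pi_\delta(2\pi\gamma)^{\|\delta\|_0/2}e^{-h_\gamma(\theta\vert\delta)}d\theta$ (here $\pi$ without subscript is the number $3.14\ldots$); it is well-defined when its normalizing constant $\sum_\delta \pi_\delta(2\pi\gamma)^{\|\delta\|_0/2}\int_{\mathbb{R}^d}e^{-h_\gamma(\theta\vert\delta)}d\theta$ is finite. Let $\tilde\Pi_\gamma$ be the probability measure on $\Delta\times\mathbb{R}^d$ given by $$\tilde\Pi_\gamma(\delta,d\theta\vert z)\propto\pi_\delta\left(\frac{1}{2\pi\gamma}\right)^{\frac{d-\|\delta\|_0}{2}}e^{-\frac{1}{2\gamma}\|\theta-\theta_\delta\|^2}e^{-h(\theta_\delta\vert\delta)}d\theta,$$ and set $$r_\gamma(\delta,\theta)=\langle\nabla\ell(\theta)-\nabla\ell(\theta_\delta),\theta-\theta_\delta\rangle+\frac{\gamma}{2}\|\delta\cdot\nabla\ell(\theta)+\delta\cdot g(\theta_\delta\vert\delta)\|^2,\qquad \varrho_\gamma(z)=\log\int e^{r_\gamma(\delta,\theta)}\tilde\Pi_\gamma(d\delta,d\theta\vert z).$$ The space $\Delta\times\mathbb{R}^d$ carries the metric $\sqrt{\|\delta_1-\delta_2\|_0^2+\|\theta_1-\theta_2\|^2}$.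 On a separable complete metric space, $\mathsf{d}_\beta(\mu_1,\mu_2)=\sup|\int f d\mu_1-\int f d\mu_2|$, the supremum over measurable real $f$ with $\|f\|_\infty+\|f\|_{\mathsf L}\le1$, where $\|f\|_\infty=\sup|f|$ and $\|f\|_{\mathsf L}$ is the Lipschitz constant of $f$. *)

theory Defs
  imports "HOL-Probability.Probability"
begin

section \<open>Extended exponential and logarithm\<close>

definition eexp :: "ereal \<Rightarrow> ennreal" where
  "eexp x = (if x = -\<infinity> then 0 else if x = \<infinity> then \<infinity> else ennreal (exp (real_of_ereal x)))"

definition eln :: "ennreal \<Rightarrow> ereal" where
  "eln x = (if x = 0 then -\<infinity> else if x = \<infinity> then \<infinity> else ereal (ln (enn2real x)))"


section \<open>Convex analysis for extended-real-valued functions\<close>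

text \<open>The next notion is only used for functions that never take the value \<open>-\<infinity>\<close>, and
  \<open>0 * \<infinity> = 0\<close> holds in \<^typ>\<open>ereal\<close>.\<close>

definition ereal_convex :: "('a::real_vector \<Rightarrow> ereal) \<Rightarrow> bool" where
  "ereal_convex F \<longleftrightarrow> (\<forall>x y. \<forall>t\<in>{0..1}.
     F ((1 - t) *\<^sub>R x + t *\<^sub>R y) \<le> ereal (1 - t) * F x + ereal t * F y)"

definition lower_semicont :: "('a::topological_space \<Rightarrow> ereal) \<Rightarrow> bool" where
  "lower_semicont F \<longleftrightarrow> (\<forall>x. F x \<le> Liminf (at x) F)"

definition is_subgradient :: "('a::real_inner \<Rightarrow> ereal) \<Rightarrow> 'a \<Rightarrow> 'a \<Rightarrow> bool" where
  "is_subgradient F v x \<longleftrightarrow> (\<forall>u. F x + ereal (v \<bullet> (u - x)) \<le> F u)"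

definition grad :: "('a::real_inner \<Rightarrow> real) \<Rightarrow> 'a \<Rightarrow> 'a" where
  "grad f x = (THE D. GDERIV f x :> D)"

text \<open>\<open>G\<close> is the gradient and \<open>H\<close> the Hessian matrix.\<close>

definition twice_cont_diff :: "(real ^ 'n \<Rightarrow> real) \<Rightarrow> bool" where
  "twice_cont_diff f \<longleftrightarrow> (\<exists>(G :: real ^ 'n \<Rightarrow> real ^ 'n) (H :: real ^ 'n \<Rightarrow> real ^ 'n ^ 'n).
     (\<forall>x. GDERIV f x :> G x) \<and>
     (\<forall>x. (G has_derivative (\<lambda>v. H x *v v)) (at x)) \<and>
     continuous_on UNIV H)"


section \<open>The bounded Lipschitz distance\<close>

definition sup_norm_on :: "'a set \<Rightarrow> ('a \<Rightarrow> real) \<Rightarrow> ereal" where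
  "sup_norm_on X f = (SUP x\<in>X. ereal \<bar>f x\<bar>)"

definition lip_const_on :: "'a set \<Rightarrow> ('a \<Rightarrow> 'a \<Rightarrow> real) \<Rightarrow> ('a \<Rightarrow> real) \<Rightarrow> ereal" where
  "lip_const_on X D f =
     Inf {ereal L | L. 0 \<le> L \<and> (\<forall>x\<in>X. \<forall>y\<in>X. \<bar>f x - f y\<bar> \<le> L * D x y)}"

text \<open>\<open>D\<close> is the metric; both measures live on the same measurable space.\<close>

definition d_beta :: "('a \<Rightarrow> 'a \<Rightarrow> real) \<Rightarrow> 'a measure \<Rightarrow> 'a measure \<Rightarrow> ereal" where
  "d_beta D M N =
     (SUP f \<in> {f. f \<in> borel_measurable M \<and> f \<in> borel_measurable N \<and>
                   sup_norm_on (space M) f + lip_const_on (space M) D f \<le> 1}.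
        ereal \<bar>(\<integral>x. f x \<partial>M) - (\<integral>x. f x \<partial>N)\<bar>)"


section \<open>Models, sparse vectors and measures on \<open>\<Delta> \<times> \<real>\<^sup>d\<close>\<close>

text \<open>The dimension is \<open>d = CARD('n)\<close>. Multiplication of vectors \<^typ>\<open>real ^ 'n\<close> is
  component-wise, so that \<open>\<theta> * \<delta>\<close> is the vector \<open>\<theta>\<^sub>\<delta>\<close>.\<close>

definition Delta :: "(real ^ 'n) set" where
  "Delta = {\<delta>. \<forall>j. \<delta> $ j \<in> {0, 1}}"

definition R_sparse :: "real ^ 'n \<Rightarrow> (real ^ 'n) set" where
  "R_sparse \<delta> = {\<theta>. \<forall>j. \<delta> $ j = 0 \<longrightarrow> \<theta> $ j = 0}"

definition norm0 :: "real ^ 'n \<Rightarrow> nat" where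
  "norm0 x = card {j. x $ j \<noteq> 0}"

definition model_dist :: "(real ^ 'n) \<times> (real ^ 'n) \<Rightarrow> (real ^ 'n) \<times> (real ^ 'n) \<Rightarrow> real" where
  "model_dist x y =
     sqrt ((real (norm0 (fst x - fst y)))\<^sup>2 + (norm (snd x - snd y))\<^sup>2)"

definition nu :: "real \<Rightarrow> real measure" where
  "nu b = (if b = 0 then return borel 0 else lborel)"

definition mu :: "real ^ 'n \<Rightarrow> (real ^ 'n) measure" where
  "mu \<delta> = distr (\<Pi>\<^sub>M j\<in>UNIV. nu (\<delta> $ j)) borel (\<lambda>x. \<chi> j. x j)"

text \<open>The measure \<open>K(\<delta>, d\<theta>)\<close> on \<open>\<Delta> \<times> \<real>\<^sup>d\<close>, for a family \<open>K\<close> of Borel measures.\<close>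

definition joint_measure ::
    "(real ^ 'n \<Rightarrow> (real ^ 'n) measure) \<Rightarrow> ((real ^ 'n) \<times> (real ^ 'n)) measure" where
  "joint_measure K = measure_of (Delta \<times> UNIV) (sets (count_space Delta \<Otimes>\<^sub>M borel))
     (\<lambda>A. \<Sum>\<delta>\<in>Delta. emeasure (K \<delta>) (Pair \<delta> -` A))"

definition normalize_measure :: "'a measure \<Rightarrow> 'a measure" where
  "normalize_measure M = scale_measure (inverse (emeasure M (space M))) M"


section \<open>The posterior distribution and its approximation\<close>

text \<open>Below, \<open>l\<close> is the negative log-likelihood, \<open>w \<delta>\<close> the prior probability of the model
  \<open>\<delta>\<close>, \<open>p\<close> the prior density of a component, and \<open>g \<theta> \<delta>\<close> a sub-gradient at \<open>\<theta>\<close> of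
  \<open>\<lambda>u. pen p u \<delta>\<close>.\<close>

definition neg_log_lik :: "(real ^ 'n \<Rightarrow> 'z \<Rightarrow> real) \<Rightarrow> 'z \<Rightarrow> real ^ 'n \<Rightarrow> real" where
  "neg_log_lik f z \<theta> = - ln (f \<theta> z)"

definition pen :: "(real \<Rightarrow> real) \<Rightarrow> real ^ 'n \<Rightarrow> real ^ 'n \<Rightarrow> ereal" where
  "pen p \<theta> \<delta> = (if \<theta> \<in> R_sparse \<delta> then ereal (- (\<Sum>j | \<delta> $ j = 1. ln (p (\<theta> $ j)))) else \<infinity>)"

definition h_post :: "(real ^ 'n \<Rightarrow> real) \<Rightarrow> (real \<Rightarrow> real) \<Rightarrow> real ^ 'n \<Rightarrow> real ^ 'n \<Rightarrow> ereal" where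
  "h_post l p \<theta> \<delta> = ereal (l \<theta>) + pen p \<theta> \<delta>"

text \<open>The infimum is attained when \<open>\<gamma> > 0\<close> and \<open>\<lambda>u. pen p u \<delta>\<close> is convex, lower
  semi-continuous and proper.\<close>

definition h_gamma ::
    "real \<Rightarrow> (real ^ 'n \<Rightarrow> real) \<Rightarrow> (real \<Rightarrow> real) \<Rightarrow> real ^ 'n \<Rightarrow> real ^ 'n \<Rightarrow> ereal" where
  "h_gamma \<gamma> l p \<theta> \<delta> =
     (INF u. ereal (l \<theta> + grad l \<theta> \<bullet> (u - \<theta>)) + pen p u \<delta> + ereal (1 / (2 * \<gamma>) * (norm (u - \<theta>))\<^sup>2))"

definition posterior ::
    "(real ^ 'n \<Rightarrow> real) \<Rightarrow> (real ^ 'n \<Rightarrow> real) \<Rightarrow> (real \<Rightarrow> real) \<Rightarrow>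
     ((real ^ 'n) \<times> (real ^ 'n)) measure" where
  "posterior l w p = normalize_measure (joint_measure (\<lambda>\<delta>.
     density (mu \<delta>) (\<lambda>\<theta>. ennreal (w \<delta>) * eexp (- h_post l p \<theta> \<delta>))))"

definition posterior_gamma ::
    "real \<Rightarrow> (real ^ 'n \<Rightarrow> real) \<Rightarrow> (real ^ 'n \<Rightarrow> real) \<Rightarrow> (real \<Rightarrow> real) \<Rightarrow>
     ((real ^ 'n) \<times> (real ^ 'n)) measure" where
  "posterior_gamma \<gamma> l w p = normalize_measure (joint_measure (\<lambda>\<delta>.
     density lborel (\<lambda>\<theta>. ennreal (w \<delta> * (2 * pi * \<gamma>) powr (real (norm0 \<delta>) / 2)) *
       eexp (- h_gamma \<gamma> l p \<theta> \<delta>))))"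

definition normalizer_gamma ::
    "real \<Rightarrow> (real ^ 'n \<Rightarrow> real) \<Rightarrow> (real ^ 'n \<Rightarrow> real) \<Rightarrow> (real \<Rightarrow> real) \<Rightarrow> ennreal" where
  "normalizer_gamma \<gamma> l w p =
     (\<Sum>\<delta>\<in>Delta. ennreal (w \<delta> * (2 * pi * \<gamma>) powr (real (norm0 \<delta>) / 2)) *
        (\<integral>\<^sup>+\<theta>. eexp (- h_gamma \<gamma> l p \<theta> \<delta>) \<partial>lborel))"

definition posterior_tilde ::
    "real \<Rightarrow> (real ^ 'n \<Rightarrow> real) \<Rightarrow> (real ^ 'n \<Rightarrow> real) \<Rightarrow> (real \<Rightarrow> real) \<Rightarrow>
     ((real ^ 'n) \<times> (real ^ 'n)) measure" where
  "posterior_tilde \<gamma> l w p = normalize_measure (joint_measure (\<lambda>\<delta>.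
     density lborel (\<lambda>\<theta>.
       ennreal (w \<delta> * (1 / (2 * pi * \<gamma>)) powr ((real CARD('n) - real (norm0 \<delta>)) / 2) *
         exp (- (1 / (2 * \<gamma>)) * (norm (\<theta> - \<theta> * \<delta>))\<^sup>2)) *
       eexp (- h_post l p (\<theta> * \<delta>) \<delta>))))"

definition r_gamma ::
    "real \<Rightarrow> (real ^ 'n \<Rightarrow> real) \<Rightarrow> (real ^ 'n \<Rightarrow> real ^ 'n \<Rightarrow> real ^ 'n) \<Rightarrow>
     real ^ 'n \<Rightarrow> real ^ 'n \<Rightarrow> real" where
  "r_gamma \<gamma> l g \<delta> \<theta> =
     (grad l \<theta> - grad l (\<theta> * \<delta>)) \<bullet> (\<theta> - \<theta> * \<delta>) +
     \<gamma> / 2 * (norm (\<delta> * grad l \<theta> + \<delta> * g (\<theta> * \<delta>) \<delta>))\<^sup>2"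

text \<open>No measurability of the choice \<open>g\<close> of sub-gradients is assumed. The vector
  \<open>\<delta> * g (\<theta> * \<delta>) \<delta>\<close> is determined up to a Borel null set, and \<^const>\<open>nn_integral\<close> does not
  see null sets, also for integrands that are not measurable.\<close>

definition varrho ::
    "real \<Rightarrow> (real ^ 'n \<Rightarrow> real) \<Rightarrow> (real ^ 'n \<Rightarrow> real) \<Rightarrow> (real \<Rightarrow> real) \<Rightarrow>
     (real ^ 'n \<Rightarrow> real ^ 'n \<Rightarrow> real ^ 'n) \<Rightarrow> ereal" where
  "varrho \<gamma> l w p g =
     eln (\<integral>\<^sup>+x. ennreal (exp (r_gamma \<gamma> l g (fst x) (snd x))) \<partial>posterior_tilde \<gamma> l w p)"

definition R_const :: "(real ^ 'n \<Rightarrow> real) \<Rightarrow> (real \<Rightarrow> real) \<Rightarrow> ereal" where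
  "R_const l p = (MAX \<delta>\<in>Delta. INF \<theta>. ereal (l (\<theta> * \<delta>)) + pen p (\<theta> * \<delta>) \<delta>)"

end

theory Submission
  imports Defs
begin

text \<open>
  Write \<open>\<theta>\<^sub>\<delta> = \<theta> * \<delta>\<close> and let \<open>H\<close> be the negative log-posterior, read as a function of
  \<open>\<theta>\<close> through \<open>\<theta>\<^sub>\<delta>\<close>. The intermediate measure \<open>\<Pi>~\<close> (\<open>posterior_tilde\<close>) draws \<open>(\<delta>, \<theta>\<^sub>\<delta>)\<close> from the
  posterior and fills the coordinates with \<open>\<delta>\<^sub>j = 0\<close> by independent centred Gaussians of
  variance \<open>\<gamma>\<close>. It is close to both measures of the theorem, for different reasons.

  Against the posterior: the posterior is the image of \<open>\<Pi>~\<close> under \<open>(\<delta>, \<theta>) \<mapsto> (\<delta>, \<theta>\<^sub>\<delta>)\<close>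
  (\<open>posterior_eq\<close>). A 1-Lipschitz function changes by at most \<open>\<parallel>\<theta> - \<theta>\<^sub>\<delta>\<parallel>\<close> under this map, and
  this distance has second moment at most \<open>\<gamma> d\<close> (\<open>second_moment_tilde\<close>), which yields the term
  \<open>sqrt (\<gamma> d)\<close>.

  Against the approximation: its density with respect to \<open>\<Pi>~\<close> is proportional to
  \<open>exp (log_ratio)\<close>. Taking \<open>u = \<theta>\<^sub>\<delta>\<close> in the minimum that defines \<open>h_gamma\<close>, together with convexity of
  \<open>l\<close>, gives \<open>0 \<le> log_ratio\<close>; replacing the penalty by its affine minorant at \<open>\<theta>\<^sub>\<delta>\<close> and
  minimizing the resulting quadratic gives \<open>log_ratio \<le> r_gamma\<close> (\<open>log_ratio_bounds\<close>). Hence the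
  normalized density is at least \<open>exp (- varrho)\<close>, and a probability density that is bounded below
  by \<open>\<kappa>\<close> is at distance at most \<open>2 (1 - \<kappa>)\<close> from the constant \<open>1\<close> in \<open>L\<^sup>1\<close>.

  It remains to bound \<open>exp varrho\<close>, the integral of \<open>exp r_gamma\<close> under \<open>\<Pi>~\<close>, and this also shows
  that the approximation can be normalized. The growth conditions on the gradients give
  \<open>r_gamma \<le> 3 \<gamma> c(\<delta>) / 2 + 3 \<gamma> L2 H + (11/8) L1 \<parallel>\<theta> - \<theta>\<^sub>\<delta>\<parallel>\<^sup>2\<close> (\<open>r_gamma_le\<close>). The last term is
  a Gaussian exponential moment. The middle one replaces the density \<open>exp (- H)\<close> by the tempered
  \<open>exp (- (1 - t) H)\<close> with \<open>t = 3 \<gamma> L2\<close>; by convexity of \<open>H\<close> along the contraction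
  \<open>\<theta> \<mapsto> (1 - t) \<theta> + t \<theta>\<^sub>0\<close> and a linear change of variables this costs at most a factor
  \<open>exp (t H(\<theta>\<^sub>0)) / (1 - t) ^ k\<close>, where \<open>k\<close> is the number of active coordinates
  (\<open>tempered_integral_le\<close>). Both costs are exponentials of the required form because
  \<open>1 / (1 - t) \<le> exp (2 t)\<close> for \<open>t \<le> 3/4\<close>, and \<open>4 \<gamma> max L1 L2 \<le> 1\<close> places both parameters in that range.
\<close>

section \<open>Product measures on vectors\<close>

definition vec_measure :: "('n::finite \<Rightarrow> real measure) \<Rightarrow> (real ^ 'n) measure" where
  "vec_measure N = distr (\<Pi>\<^sub>M j\<in>UNIV. N j) borel (\<lambda>x. \<chi> j. x j)"

lemma measurable_vec_nth [measurable]: "(\<lambda>x :: real ^ 'n. x $ j) \<in> borel_measurable borel"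
  by (intro borel_measurable_continuous_onI continuous_intros)

lemma borel_measurable_vec_lambda [measurable (raw)]:
  fixes f :: "'a \<Rightarrow> 'n::finite \<Rightarrow> real"
  assumes "\<And>j. (\<lambda>x. f x j) \<in> borel_measurable M"
  shows "(\<lambda>x. \<chi> j. f x j) \<in> borel_measurable M"
  by (rule borel_measurable_euclidean_space[THEN iffD2]) (use assms in \<open>auto simp: Basis_vec_def inner_axis\<close>)

lemma measurable_vec_lambda_PiM:
  fixes N :: "'n::finite \<Rightarrow> real measure"
  assumes "\<And>j. sets (N j) = sets borel"
  shows "(\<lambda>x. \<chi> j. x j) \<in> borel_measurable (\<Pi>\<^sub>M j\<in>UNIV. N j)"
proof (rule borel_measurable_euclidean_space[THEN iffD2], rule ballI)
  fix i :: "real ^ 'n" assume "i \<in> Basis"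
  then obtain j where i: "i = axis j 1" by (auto simp: Basis_vec_def)
  have "(\<lambda>x. x j) \<in> measurable (\<Pi>\<^sub>M j\<in>(UNIV :: 'n set). N j) (N j)"
    by (rule measurable_component_singleton) simp
  then show "(\<lambda>x. vec_lambda x \<bullet> i) \<in> borel_measurable (\<Pi>\<^sub>M j\<in>(UNIV :: 'n set). N j)"
    unfolding measurable_cong_sets[OF refl assms] by (simp add: i inner_axis)
qed

lemma prod_indicator_UNIV:
  "(\<Prod>j\<in>UNIV. indicator (A j) (x j)) = (indicator (Pi\<^sub>E UNIV A) x :: ennreal)"
  for A :: "'n::finite \<Rightarrow> 'a set"
proof (cases "x \<in> Pi\<^sub>E UNIV A")
  case True
  then show ?thesis by (auto intro!: prod.neutral simp: indicator_def PiE_def Pi_def)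
next
  case False
  then obtain j where "x j \<notin> A j" by auto
  then have "(\<Prod>j\<in>UNIV. indicator (A j) (x j)) = (0 :: ennreal)"
    by (intro prod_zero bexI[of _ j]) auto
  with False show ?thesis by simp
qed

text \<open>Measures on \<open>real ^ 'n\<close> with independent coordinates can be transformed one coordinate at
  a time: if each factor \<open>N j\<close> is the image under \<open>\<phi> j\<close> of \<open>M j\<close> weighted by \<open>\<rho> j\<close>, then the same
  holds for the products, because the two sides agree on boxes. Both the Gaussian smoothing and the
  rescaling of active coordinates are instances.\<close>
lemma nn_integral_vec_measure_transform:
  fixes M N :: "'n::finite \<Rightarrow> real measure" and \<rho> :: "'n \<Rightarrow> real \<Rightarrow> ennreal"
  assumes sf: "\<And>j. sigma_finite_measure (M j)" "\<And>j. sigma_finite_measure (N j)"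
    and sets: "\<And>j. sets (M j) = sets borel" "\<And>j. sets (N j) = sets borel"
    and meas [measurable]: "\<And>j. \<rho> j \<in> borel_measurable borel" "\<And>j. \<phi> j \<in> borel_measurable borel"
    and N_eq: "\<And>j A. A \<in> sets borel \<Longrightarrow>
      emeasure (N j) A = (\<integral>\<^sup>+x. \<rho> j x * indicator A (\<phi> j x) \<partial>M j)"
    and F [measurable]: "F \<in> borel_measurable borel"
  shows "(\<integral>\<^sup>+x. (\<Prod>j\<in>UNIV. \<rho> j (x $ j)) * F (\<chi> j. \<phi> j (x $ j)) \<partial>vec_measure M)
    = (\<integral>\<^sup>+x. F x \<partial>vec_measure N)"
proof -
  interpret M: product_sigma_finite M by (intro product_sigma_finite.intro sf)
  interpret N: product_sigma_finite N by (intro product_sigma_finite.intro sf)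
  let ?M = "\<Pi>\<^sub>M j\<in>UNIV. M j" and ?N = "\<Pi>\<^sub>M j\<in>UNIV. N j"
  let ?d = "\<lambda>y. \<Prod>j\<in>UNIV. \<rho> j (y j)"
  note [measurable_cong] = sets
  have comp [measurable]: "(\<lambda>y. y j) \<in> borel_measurable ?M" for j
    using measurable_component_singleton[of j UNIV M] unfolding measurable_cong_sets[OF refl sets(1)] by simp
  have [measurable]: "(\<lambda>x. \<chi> j. x j) \<in> borel_measurable ?M" "(\<lambda>x. \<chi> j. x j) \<in> borel_measurable ?N"
    by (rule measurable_vec_lambda_PiM, rule sets)+
  have map [measurable]: "(\<lambda>y j. \<phi> j (y j)) \<in> measurable ?M ?N"
    by (rule measurable_PiM_single') (auto simp: sets_eq_imp_space_eq[OF sets(2)] sets)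
  have "distr (density ?M ?d) ?N (\<lambda>y j. \<phi> j (y j)) = ?N"
  proof (rule N.PiM_eqI)
    fix A assume "\<And>i. i \<in> UNIV \<Longrightarrow> A i \<in> sets (N i)"
    then have A [measurable]: "\<And>i. A i \<in> sets borel" by (simp add: sets)
    have "emeasure (distr (density ?M ?d) ?N (\<lambda>y j. \<phi> j (y j))) (Pi\<^sub>E UNIV A)
      = (\<integral>\<^sup>+y. ?d y * indicator (Pi\<^sub>E UNIV A) (\<lambda>j. \<phi> j (y j)) \<partial>?M)"
    proof (subst emeasure_distr)
      show "Pi\<^sub>E UNIV A \<in> sets ?N" using A by (intro sets_PiM_I_finite) (auto simp: sets)
      then have "(\<lambda>y j. \<phi> j (y j)) -` Pi\<^sub>E UNIV A \<inter> space (density ?M ?d) \<in> sets ?M"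
        by (simp add: measurable_sets[OF map])
      then show "emeasure (density ?M ?d) ((\<lambda>y j. \<phi> j (y j)) -` Pi\<^sub>E UNIV A \<inter> space (density ?M ?d))
        = (\<integral>\<^sup>+y. ?d y * indicator (Pi\<^sub>E UNIV A) (\<lambda>j. \<phi> j (y j)) \<partial>?M)"
        by (subst emeasure_density) (auto intro!: nn_integral_cong simp: indicator_def)
    qed (use map in simp)
    also have "\<dots> = (\<integral>\<^sup>+y. (\<Prod>j\<in>UNIV. \<rho> j (y j) * indicator (A j) (\<phi> j (y j))) \<partial>?M)"
      by (simp add: prod.distrib prod_indicator_UNIV)
    also have "\<dots> = (\<Prod>j\<in>UNIV. \<integral>\<^sup>+x. \<rho> j x * indicator (A j) (\<phi> j x) \<partial>M j)"
      by (rule M.product_nn_integral_prod) (simp_all add: measurable_cong_sets[OF sets(1) refl])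
    also have "\<dots> = (\<Prod>j\<in>UNIV. emeasure (N j) (A j))"
      by (simp add: N_eq)
    finally show "emeasure (distr (density ?M ?d) ?N (\<lambda>y j. \<phi> j (y j))) (Pi\<^sub>E UNIV A)
      = (\<Prod>i\<in>UNIV. emeasure (N i) (A i))" .
  qed simp_all
  then have "(\<integral>\<^sup>+x. F x \<partial>vec_measure N)
    = (\<integral>\<^sup>+x. F (\<chi> j. x j) \<partial>distr (density ?M ?d) ?N (\<lambda>y j. \<phi> j (y j)))"
    by (simp add: vec_measure_def nn_integral_distr)
  also have "\<dots> = (\<integral>\<^sup>+y. ?d y * F (\<chi> j. \<phi> j (y j)) \<partial>?M)"
    by (simp add: nn_integral_distr nn_integral_density)
  also have "\<dots> = (\<integral>\<^sup>+x. (\<Prod>j\<in>UNIV. \<rho> j (x $ j)) * F (\<chi> j. \<phi> j (x $ j)) \<partial>vec_measure M)"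
    by (simp add: vec_measure_def nn_integral_distr)
  finally show ?thesis ..
qed

lemma lborel_eq_vec_measure: "lborel = vec_measure (\<lambda>_ :: 'n::finite. lborel)"
proof (rule lborel_eqI)
  interpret product_sigma_finite "\<lambda>_ :: 'n. lborel" by (intro product_sigma_finite.intro sigma_finite_lborel)
  fix l u :: "real ^ 'n"
  assume *: "\<And>b. b \<in> Basis \<Longrightarrow> l \<bullet> b \<le> u \<bullet> b"
  have lu: "l $ j \<le> u $ j" for j
    using *[of "axis j 1"] by (simp add: inner_axis)
  have box: "(\<lambda>x. \<chi> j. x j) -` box l u \<inter> space (\<Pi>\<^sub>M j\<in>(UNIV :: 'n set). lborel)
      = (\<Pi>\<^sub>E j\<in>UNIV. {l $ j <..< u $ j})"
    by (auto simp: space_PiM mem_box_cart PiE_def Pi_def)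
  have "emeasure (vec_measure (\<lambda>_ :: 'n. lborel)) (box l u)
      = emeasure (\<Pi>\<^sub>M j\<in>(UNIV :: 'n set). lborel) (\<Pi>\<^sub>E j\<in>UNIV. {l $ j <..< u $ j})"
    unfolding vec_measure_def
    by (subst emeasure_distr) (auto intro!: measurable_vec_lambda_PiM simp: box[symmetric])
  also have "\<dots> = (\<Prod>j\<in>UNIV. ennreal (u $ j - l $ j))"
    using lu by (subst emeasure_PiM) auto
  also have "\<dots> = ennreal (\<Prod>j\<in>UNIV. u $ j - l $ j)"
    using lu by (intro prod_ennreal) auto
  also have "(\<Prod>j\<in>UNIV. u $ j - l $ j) = (\<Prod>b\<in>Basis. (u - l) \<bullet> b)"
    by (auto simp: Basis_vec_def UNION_singleton_eq_range prod.reindex inj_on_def axis_eq_axis inner_axis)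
  finally show "emeasure (vec_measure (\<lambda>_ :: 'n. lborel)) (box l u)
      = ennreal (\<Prod>b\<in>Basis. (u - l) \<bullet> b)" .
qed (simp add: vec_measure_def)

section \<open>The spike-and-slab reference measures\<close>

lemma mu_eq_vec_measure: "mu \<delta> = vec_measure (\<lambda>j. nu (\<delta> $ j))"
  by (simp add: mu_def vec_measure_def)

lemma sets_nu [simp, measurable_cong]: "sets (nu b) = sets borel"
  by (simp add: nu_def)

lemma sigma_finite_nu: "sigma_finite_measure (nu b)"
  using prob_space_return[of "0::real" borel, THEN prob_space_imp_sigma_finite] sigma_finite_lborel
  by (auto simp: nu_def)

lemma sets_mu [simp, measurable_cong]: "sets (mu \<delta>) = sets borel"
  by (simp add: mu_def)

lemma space_mu [simp]: "space (mu \<delta>) = UNIV"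
  by (simp add: mu_def)

text \<open>Multiplication by \<open>0\<close> sends any probability measure on the line to the Dirac mass at \<open>0\<close>,
  so Lebesgue measure weighted by probability densities \<open>q j\<close> in the inactive coordinates is mapped
  to \<open>mu \<delta>\<close> by \<open>\<theta> \<mapsto> \<theta> * \<delta>\<close>. The freedom in \<open>q\<close> is what makes it possible to treat mass, second
  moment and exponential moment of the Gaussian in the same way.\<close>
lemma nn_integral_mu_eq_lborel:
  fixes \<delta> :: "real ^ 'n"
  assumes \<delta>: "\<delta> \<in> Delta"
    and q [measurable]: "\<And>j. q j \<in> borel_measurable borel"
    and q1: "\<And>j. \<delta> $ j = 0 \<Longrightarrow> (\<integral>\<^sup>+x. q j x \<partial>lborel) = 1"
    and F: "F \<in> borel_measurable borel"
  shows "(\<integral>\<^sup>+\<theta>. (\<Prod>j | \<delta> $ j = 0. q j (\<theta> $ j)) * F (\<theta> * \<delta>) \<partial>lborel) = (\<integral>\<^sup>+\<theta>. F \<theta> \<partial>mu \<delta>)"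
proof -
  have \<delta>01: "\<delta> $ j = 0 \<or> \<delta> $ j = 1" for j using \<delta> by (auto simp: Delta_def)
  let ?\<rho> = "\<lambda>j x. if \<delta> $ j = 0 then q j x else 1"
  have "(\<integral>\<^sup>+\<theta>. F \<theta> \<partial>mu \<delta>)
    = (\<integral>\<^sup>+x. (\<Prod>j\<in>UNIV. ?\<rho> j (x $ j)) * F (\<chi> j. x $ j * \<delta> $ j) \<partial>vec_measure (\<lambda>_. lborel))"
    unfolding mu_eq_vec_measure
  proof (rule nn_integral_vec_measure_transform[symmetric, OF _ _ _ _ _ _ _ F])
    fix j and A :: "real set" assume A [measurable]: "A \<in> sets borel"
    show "emeasure (nu (\<delta> $ j)) A = (\<integral>\<^sup>+x. ?\<rho> j x * indicator A (x * \<delta> $ j) \<partial>lborel)"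
      using \<delta>01[of j] A q1[of j] by (auto simp: nu_def nn_integral_multc)
  qed (auto simp: sigma_finite_lborel sigma_finite_nu)
  also have "(\<lambda>x. \<chi> j. x $ j * \<delta> $ j) = (\<lambda>x. x * \<delta>)"
    by (simp add: fun_eq_iff vec_eq_iff)
  then have "(\<integral>\<^sup>+x. (\<Prod>j\<in>UNIV. ?\<rho> j (x $ j)) * F (\<chi> j. x $ j * \<delta> $ j) \<partial>vec_measure (\<lambda>_. lborel))
     = (\<integral>\<^sup>+x. (\<Prod>j\<in>UNIV. ?\<rho> j (x $ j)) * F (x * \<delta>) \<partial>lborel)"
    by (simp add: lborel_eq_vec_measure fun_eq_iff)
  also have "\<dots> = (\<integral>\<^sup>+\<theta>. (\<Prod>j | \<delta> $ j = 0. q j (\<theta> $ j)) * F (\<theta> * \<delta>) \<partial>lborel)"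
    by (simp add: prod.If_cases)
  finally show ?thesis ..
qed

lemma norm0_Delta: "\<delta> \<in> Delta \<Longrightarrow> norm0 \<delta> = card {j. \<delta> $ j = 1}"
  unfolding norm0_def by (rule arg_cong[where f = card]) (auto simp: Delta_def)

text \<open>Only the \<open>norm0 \<delta>\<close> Lebesgue coordinates contribute to the Jacobian; an atom at \<open>0\<close> is fixed by
  \<open>x \<mapsto> s x\<close>, and the translation does not move it because \<open>a\<close> is sparse.\<close>
lemma nn_integral_mu_affine:
  fixes \<delta> :: "real ^ 'n"
  assumes \<delta>: "\<delta> \<in> Delta" and s: "0 < s"
    and a: "a \<in> R_sparse \<delta>"
    and F: "F \<in> borel_measurable borel"
  shows "ennreal s ^ norm0 \<delta> * (\<integral>\<^sup>+\<theta>. F (s *\<^sub>R \<theta> + a) \<partial>mu \<delta>) = (\<integral>\<^sup>+\<theta>. F \<theta> \<partial>mu \<delta>)"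
proof -
  have \<delta>01: "\<delta> $ j = 0 \<or> \<delta> $ j = 1" for j using \<delta> by (auto simp: Delta_def)
  note F [measurable]
  let ?\<rho> = "\<lambda>j (x::real). if \<delta> $ j = 1 then ennreal s else 1"
  have "(\<integral>\<^sup>+\<theta>. F \<theta> \<partial>mu \<delta>)
    = (\<integral>\<^sup>+x. (\<Prod>j\<in>UNIV. ?\<rho> j (x $ j)) * F (\<chi> j. s * x $ j + a $ j) \<partial>mu \<delta>)"
    unfolding mu_eq_vec_measure
  proof (rule nn_integral_vec_measure_transform[symmetric, OF _ _ _ _ _ _ _ F])
    fix j and A :: "real set" assume A [measurable]: "A \<in> sets borel"
    have "emeasure lborel A = (\<integral>\<^sup>+x. indicator A x \<partial>lborel)" by simp
    also have "\<dots> = ennreal s * (\<integral>\<^sup>+x. indicator A (a $ j + s * x) \<partial>lborel)"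
      using s by (subst nn_integral_real_affine[where c = s and t = "a $ j"]) auto
    also have "\<dots> = (\<integral>\<^sup>+x. ennreal s * indicator A (s * x + a $ j) \<partial>lborel)"
      by (subst nn_integral_cmult[symmetric]) (auto simp: add.commute)
    finally show "emeasure (nu (\<delta> $ j)) A = (\<integral>\<^sup>+x. ?\<rho> j x * indicator A (s * x + a $ j) \<partial>nu (\<delta> $ j))"
      using \<delta>01[of j] A a by (auto simp: nu_def nn_integral_return R_sparse_def)
  qed (auto simp: sigma_finite_nu)
  also have "(\<lambda>x. \<chi> j. s * x $ j + a $ j) = (\<lambda>x. s *\<^sub>R x + a)"
    by (simp add: fun_eq_iff vec_eq_iff)
  then have "(\<integral>\<^sup>+x. (\<Prod>j\<in>UNIV. ?\<rho> j (x $ j)) * F (\<chi> j. s * x $ j + a $ j) \<partial>mu \<delta>)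
    = (\<integral>\<^sup>+x. ennreal s ^ norm0 \<delta> * F (s *\<^sub>R x + a) \<partial>mu \<delta>)"
    by (simp add: fun_eq_iff prod.If_cases norm0_Delta[OF \<delta>])
  also have "\<dots> = ennreal s ^ norm0 \<delta> * (\<integral>\<^sup>+x. F (s *\<^sub>R x + a) \<partial>mu \<delta>)"
    by (rule nn_integral_cmult) measurable
  finally show ?thesis ..
qed

lemma nn_integral_mu_prod:
  fixes \<delta> :: "real ^ 'n"
  assumes \<delta>: "\<delta> \<in> Delta" and p [measurable]: "p \<in> borel_measurable borel"
    and p1: "(\<integral>\<^sup>+x. p x \<partial>lborel) = 1"
  shows "(\<integral>\<^sup>+\<theta>. (\<Prod>j | \<delta> $ j = 1. p (\<theta> $ j)) \<partial>mu \<delta>) = 1"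
proof -
  have \<delta>01: "\<delta> $ j = 0 \<or> \<delta> $ j = 1" for j using \<delta> by (auto simp: Delta_def)
  interpret product_sigma_finite "\<lambda>j. nu (\<delta> $ j)" by (intro product_sigma_finite.intro sigma_finite_nu)
  let ?\<rho> = "\<lambda>j x. if \<delta> $ j = 1 then p x else 1"
  have [measurable]: "(\<lambda>x. \<chi> j. x j) \<in> borel_measurable (\<Pi>\<^sub>M j\<in>UNIV. nu (\<delta> $ j))"
    by (rule measurable_vec_lambda_PiM) simp
  have "(\<integral>\<^sup>+\<theta>. (\<Prod>j | \<delta> $ j = 1. p (\<theta> $ j)) \<partial>mu \<delta>)
    = (\<integral>\<^sup>+x. (\<Prod>j\<in>UNIV. ?\<rho> j (x j)) \<partial>(\<Pi>\<^sub>M j\<in>UNIV. nu (\<delta> $ j)))"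
    by (simp add: mu_def nn_integral_distr prod.If_cases)
  also have "\<dots> = (\<Prod>j\<in>UNIV. \<integral>\<^sup>+x. ?\<rho> j x \<partial>nu (\<delta> $ j))"
    by (rule product_nn_integral_prod) auto
  also have "\<dots> = 1"
  proof (rule prod.neutral, safe)
    fix j show "(\<integral>\<^sup>+x. ?\<rho> j x \<partial>nu (\<delta> $ j)) = 1"
      using \<delta>01[of j] p1 by (auto simp: nu_def emeasure_return)
  qed
  finally show ?thesis .
qed

section \<open>Measures on pairs of a model and a parameter\<close>

lemma finite_Delta [simp]: "finite (Delta :: (real ^ 'n) set)"
proof (rule finite_subset)
  show "(Delta :: (real ^ 'n) set) \<subseteq> vec_lambda ` (\<Pi>\<^sub>E j\<in>UNIV. {0, 1})"
  proof
    fix \<delta> :: "real ^ 'n" assume "\<delta> \<in> Delta"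
    then have "vec_nth \<delta> \<in> (\<Pi>\<^sub>E j\<in>UNIV. {0, 1})" by (auto simp: Delta_def)
    then show "\<delta> \<in> vec_lambda ` (\<Pi>\<^sub>E j\<in>UNIV. {0, 1})"
      by (metis image_eqI vec_nth_inverse)
  qed
qed (auto intro!: finite_imageI finite_PiE)

lemma zero_in_Delta: "0 \<in> Delta" by (simp add: Delta_def)

lemma one_in_Delta: "1 \<in> Delta" by (simp add: Delta_def)

lemma Delta_nonempty [simp]: "Delta \<noteq> {}"
  using zero_in_Delta by blast

abbreviation model_algebra :: "((real ^ 'n) \<times> (real ^ 'n)) measure" where
  "model_algebra \<equiv> count_space Delta \<Otimes>\<^sub>M borel"

lemma sets_joint_measure [simp, measurable_cong]:
  fixes K :: "real ^ 'n \<Rightarrow> (real ^ 'n) measure"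
  shows "sets (joint_measure K) = sets model_algebra"
proof -
  let ?S = "model_algebra :: ((real ^ 'n) \<times> (real ^ 'n)) measure"
  have "sets ?S \<subseteq> Pow (Delta \<times> UNIV)"
    using sets.space_closed[of ?S] by (simp add: space_pair_measure)
  then show ?thesis
    unfolding joint_measure_def
    using sets.sigma_sets_eq[of ?S] by (simp add: space_pair_measure)
qed

lemma space_joint_measure [simp]: "space (joint_measure K) = Delta \<times> UNIV"
  using sets_eq_imp_space_eq[OF sets_joint_measure] by (simp add: space_pair_measure)

lemma emeasure_joint_measure:
  fixes K :: "real ^ 'n \<Rightarrow> (real ^ 'n) measure"
  assumes K: "\<And>\<delta>. \<delta> \<in> Delta \<Longrightarrow> sets (K \<delta>) = sets borel"
    and A: "A \<in> sets model_algebra"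
  shows "emeasure (joint_measure K) A = (\<Sum>\<delta>\<in>Delta. emeasure (K \<delta>) (Pair \<delta> -` A))"
  unfolding joint_measure_def
proof (rule emeasure_measure_of_sigma[OF _ _ _ A])
  show "sigma_algebra (Delta \<times> UNIV) (sets (model_algebra :: ((real ^ 'n) \<times> (real ^ 'n)) measure))"
    using sets.sigma_algebra_axioms[of "model_algebra :: ((real ^ 'n) \<times> (real ^ 'n)) measure"]
    by (simp add: space_pair_measure)
  show "countably_additive (sets model_algebra) (\<lambda>A. \<Sum>\<delta>\<in>Delta. emeasure (K \<delta>) (Pair \<delta> -` A))"
  proof (rule countably_additiveI)
    fix A :: "nat \<Rightarrow> ((real ^ 'n) \<times> (real ^ 'n)) set"
    assume A: "range A \<subseteq> sets model_algebra" "disjoint_family A"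
    have "(\<Sum>i. \<Sum>\<delta>\<in>Delta. emeasure (K \<delta>) (Pair \<delta> -` A i))
      = (\<Sum>\<delta>\<in>Delta. \<Sum>i. emeasure (K \<delta>) (Pair \<delta> -` A i))"
      by (rule suminf_sum) simp
    also have "\<dots> = (\<Sum>\<delta>\<in>Delta. emeasure (K \<delta>) (Pair \<delta> -` (\<Union>i. A i)))"
    proof (rule sum.cong[OF refl])
      fix \<delta> :: "real ^ 'n" assume \<delta>: "\<delta> \<in> Delta"
      have "range (\<lambda>i. Pair \<delta> -` A i) \<subseteq> sets (K \<delta>)"
        using A(1) by (auto simp: K[OF \<delta>] intro!: sets_Pair1)
      then show "(\<Sum>i. emeasure (K \<delta>) (Pair \<delta> -` A i)) = emeasure (K \<delta>) (Pair \<delta> -` (\<Union>i. A i))"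
        using A(2) by (subst suminf_emeasure)
          (auto simp: vimage_UN disjoint_family_on_def)
    qed
    finally show "(\<Sum>i. \<Sum>\<delta>\<in>Delta. emeasure (K \<delta>) (Pair \<delta> -` A i))
      = (\<Sum>\<delta>\<in>Delta. emeasure (K \<delta>) (Pair \<delta> -` (\<Union>i. A i)))" .
  qed
qed (simp add: positive_def)

lemma joint_measure_cong:
  assumes "\<And>\<delta>. \<delta> \<in> Delta \<Longrightarrow> K \<delta> = K' \<delta>"
  shows "joint_measure K = joint_measure K'"
  unfolding joint_measure_def by (intro measure_of_eq sets.space_closed[THEN subset_trans] sum.cong)
    (auto simp: assms space_pair_measure)

lemma measurable_Pair_Delta:
  assumes "\<delta> \<in> Delta" "F \<in> measurable model_algebra N"
  shows "(\<lambda>\<theta>. F (\<delta>, \<theta>)) \<in> measurable borel N"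
  by (rule measurable_compose[OF measurable_Pair1'[of \<delta>] assms(2)]) (use assms(1) in simp)

text \<open>The measure is defined through its values on sets; this is the corresponding formula for
  integrals, by the usual extension from indicator functions.\<close>
lemma nn_integral_joint_measure:
  assumes K: "\<And>\<delta>. \<delta> \<in> Delta \<Longrightarrow> sets (K \<delta>) = sets borel"
    and F: "F \<in> borel_measurable model_algebra"
  shows "(\<integral>\<^sup>+x. F x \<partial>joint_measure K) = (\<Sum>\<delta>\<in>Delta. \<integral>\<^sup>+\<theta>. F (\<delta>, \<theta>) \<partial>K \<delta>)"
  using F
proof (induction rule: borel_measurable_induct)
  case (cong f g)
  have "(\<integral>\<^sup>+x. f x \<partial>joint_measure K) = (\<integral>\<^sup>+x. g x \<partial>joint_measure K)"
    using cong(3) by (intro nn_integral_cong) (auto simp: space_pair_measure)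
  moreover have "(\<Sum>\<delta>\<in>Delta. \<integral>\<^sup>+\<theta>. f (\<delta>, \<theta>) \<partial>K \<delta>) = (\<Sum>\<delta>\<in>Delta. \<integral>\<^sup>+\<theta>. g (\<delta>, \<theta>) \<partial>K \<delta>)"
    using cong(3) by (intro sum.cong nn_integral_cong) (auto simp: space_pair_measure)
  ultimately show ?case using cong by simp
next
  case (set A)
  have "(\<integral>\<^sup>+\<theta>. indicator A (\<delta>, \<theta>) \<partial>K \<delta>) = emeasure (K \<delta>) (Pair \<delta> -` A)" if "\<delta> \<in> Delta" for \<delta>
  proof -
    have "(\<integral>\<^sup>+\<theta>. indicator A (\<delta>, \<theta>) \<partial>K \<delta>) = (\<integral>\<^sup>+\<theta>. indicator (Pair \<delta> -` A) \<theta> \<partial>K \<delta>)"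
      by (intro nn_integral_cong) (simp add: indicator_def)
    also have "\<dots> = emeasure (K \<delta>) (Pair \<delta> -` A)"
      using sets_Pair1[OF set, of \<delta>] K[OF that] by (intro nn_integral_indicator) simp
    finally show ?thesis .
  qed
  with set K show ?case by (simp add: emeasure_joint_measure)
next
  case (mult u c)
  have "(\<lambda>\<theta>. u (\<delta>, \<theta>)) \<in> borel_measurable (K \<delta>)" if "\<delta> \<in> Delta" for \<delta>
    using measurable_Pair_Delta[OF that mult(2)] K[OF that] by (simp cong: measurable_cong_sets)
  with mult show ?case
    by (simp add: nn_integral_cmult sum_distrib_left measurable_cong_sets[OF sets_joint_measure refl])
next
  case (add u v)
  have "(\<lambda>\<theta>. u (\<delta>, \<theta>)) \<in> borel_measurable (K \<delta>)" "(\<lambda>\<theta>. v (\<delta>, \<theta>)) \<in> borel_measurable (K \<delta>)"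
    if "\<delta> \<in> Delta" for \<delta>
    using measurable_Pair_Delta[OF that add(1)] measurable_Pair_Delta[OF that add(3)] K[OF that]
    by (simp_all cong: measurable_cong_sets)
  with add show ?case
    by (simp add: nn_integral_add sum.distrib measurable_cong_sets[OF sets_joint_measure refl])
next
  case (seq U)
  have m: "(\<lambda>\<theta>. U i (\<delta>, \<theta>)) \<in> borel_measurable (K \<delta>)" if "\<delta> \<in> Delta" for \<delta> i
    using measurable_Pair_Delta[OF that seq(1)] K[OF that] by (simp cong: measurable_cong_sets)
  have "(\<integral>\<^sup>+x. (SUP i. U i) x \<partial>joint_measure K) = (SUP i. \<integral>\<^sup>+x. U i x \<partial>joint_measure K)"
    unfolding SUP_apply using seq
    by (intro nn_integral_monotone_convergence_SUP) (auto simp: measurable_cong_sets[OF sets_joint_measure refl])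
  also have "\<dots> = (SUP i. \<Sum>\<delta>\<in>Delta. \<integral>\<^sup>+\<theta>. U i (\<delta>, \<theta>) \<partial>K \<delta>)"
    using seq by simp
  also have "\<dots> = (\<Sum>\<delta>\<in>Delta. SUP i. \<integral>\<^sup>+\<theta>. U i (\<delta>, \<theta>) \<partial>K \<delta>)"
    using seq(3) by (intro ennreal_SUP_sum) (auto simp: incseq_def le_fun_def intro!: nn_integral_mono)
  also have "\<dots> = (\<Sum>\<delta>\<in>Delta. \<integral>\<^sup>+\<theta>. (SUP i. U i) (\<delta>, \<theta>) \<partial>K \<delta>)"
    unfolding SUP_apply using seq(3) m
    by (intro sum.cong nn_integral_monotone_convergence_SUP[symmetric]) (auto simp: incseq_def le_fun_def)
  finally show ?case .
qed

text \<open>Lets the model-wise densities be collected into one density on the product space, so that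
  measures on \<open>Delta \<times> UNIV\<close> can be compared by comparing densities.\<close>
lemma joint_measure_density:
  fixes K :: "real ^ 'n \<Rightarrow> (real ^ 'n) measure"
  assumes K: "\<And>\<delta>. \<delta> \<in> Delta \<Longrightarrow> sets (K \<delta>) = sets borel"
    and u: "\<And>\<delta>. \<delta> \<in> Delta \<Longrightarrow> u \<delta> \<in> borel_measurable borel"
  shows "joint_measure (\<lambda>\<delta>. density (K \<delta>) (u \<delta>)) = density (joint_measure K) (\<lambda>x. u (fst x) (snd x))"
proof (rule measure_eqI)
  fix A assume "A \<in> sets (joint_measure (\<lambda>\<delta>. density (K \<delta>) (u \<delta>)))"
  then have A [measurable]: "A \<in> sets model_algebra" by simp
  have U [measurable]: "(\<lambda>x. u (fst x) (snd x)) \<in> borel_measurable model_algebra"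
    by (rule measurable_pair_measure_countable1) (auto intro: countable_finite u)
  have "emeasure (joint_measure (\<lambda>\<delta>. density (K \<delta>) (u \<delta>))) A
    = (\<Sum>\<delta>\<in>Delta. emeasure (density (K \<delta>) (u \<delta>)) (Pair \<delta> -` A))"
    using A K by (simp add: emeasure_joint_measure)
  also have "\<dots> = (\<Sum>\<delta>\<in>Delta. \<integral>\<^sup>+\<theta>. u \<delta> \<theta> * indicator A (\<delta>, \<theta>) \<partial>K \<delta>)"
  proof (rule sum.cong[OF refl])
    fix \<delta> :: "real ^ 'n" assume \<delta>: "\<delta> \<in> Delta"
    have "emeasure (density (K \<delta>) (u \<delta>)) (Pair \<delta> -` A)
      = (\<integral>\<^sup>+\<theta>. u \<delta> \<theta> * indicator (Pair \<delta> -` A) \<theta> \<partial>K \<delta>)"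
      using u[OF \<delta>] sets_Pair1[OF A, of \<delta>] K[OF \<delta>]
      by (intro emeasure_density) (simp_all add: measurable_cong_sets[OF K[OF \<delta>] refl])
    then show "emeasure (density (K \<delta>) (u \<delta>)) (Pair \<delta> -` A)
      = (\<integral>\<^sup>+\<theta>. u \<delta> \<theta> * indicator A (\<delta>, \<theta>) \<partial>K \<delta>)"
      by (simp add: indicator_def)
  qed
  also have "\<dots> = (\<integral>\<^sup>+x. u (fst x) (snd x) * indicator A x \<partial>joint_measure K)"
    using K by (subst nn_integral_joint_measure) (simp_all, measurable)
  also have "\<dots> = emeasure (density (joint_measure K) (\<lambda>x. u (fst x) (snd x))) A"
    by (rule emeasure_density[symmetric]) measurable
  finally show "emeasure (joint_measure (\<lambda>\<delta>. density (K \<delta>) (u \<delta>))) A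
    = emeasure (density (joint_measure K) (\<lambda>x. u (fst x) (snd x))) A" .
qed simp

section \<open>Normalization\<close>

lemma sets_normalize_measure [simp, measurable_cong]: "sets (normalize_measure M) = sets M"
  by (simp add: normalize_measure_def)

lemma space_normalize_measure [simp]: "space (normalize_measure M) = space M"
  by (simp add: normalize_measure_def space_scale_measure)

lemma emeasure_normalize_measure:
  "emeasure (normalize_measure M) A = inverse (emeasure M (space M)) * emeasure M A"
  by (simp add: normalize_measure_def)

lemma nn_integral_normalize_measure:
  "F \<in> borel_measurable M \<Longrightarrow>
    (\<integral>\<^sup>+x. F x \<partial>normalize_measure M) = inverse (emeasure M (space M)) * (\<integral>\<^sup>+x. F x \<partial>M)"
  by (simp add: normalize_measure_def nn_integral_scale_measure)

lemma prob_space_normalize_measure: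
  assumes "emeasure M (space M) \<noteq> 0" "emeasure M (space M) \<noteq> \<infinity>"
  shows "prob_space (normalize_measure M)"
proof
  show "emeasure (normalize_measure M) (space (normalize_measure M)) = 1"
    using ennreal_divide_self[OF assms(1)] assms(2)
    by (simp add: emeasure_normalize_measure divide_ennreal_def mult.commute top.not_eq_extremum)
qed

lemma normalize_measure_distr:
  assumes f: "f \<in> measurable M N"
  shows "normalize_measure (distr M N f) = distr (normalize_measure M) N f"
proof (rule measure_eqI)
  fix A assume "A \<in> sets (normalize_measure (distr M N f))"
  moreover have "f \<in> measurable (normalize_measure M) N"
    using f by (simp add: measurable_cong_sets[OF sets_normalize_measure refl])
  moreover have "f -` space N \<inter> space M = space M"
    using measurable_space[OF f] by auto
  ultimately show "emeasure (normalize_measure (distr M N f)) A = emeasure (distr (normalize_measure M) N f) A"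
    using f by (simp add: emeasure_normalize_measure emeasure_distr)
qed simp

text \<open>A constant factor \<open>k\<close> in the density cancels under normalization. This is how the different
  powers of \<open>2 pi \<gamma>\<close> in the definitions of the approximation and the intermediate measure drop out.\<close>
lemma normalize_measure_density:
  fixes k :: ennreal
  assumes D: "D \<in> borel_measurable M"
    and C: "emeasure M (space M) \<noteq> 0" "emeasure M (space M) \<noteq> \<infinity>"
    and k: "k \<noteq> 0" "k \<noteq> \<infinity>"
    and Z: "(\<integral>\<^sup>+x. D x \<partial>normalize_measure M) = Z" "Z \<noteq> 0" "Z \<noteq> \<infinity>"
  shows "normalize_measure (density M (\<lambda>x. k * D x)) = density (normalize_measure M) (\<lambda>x. D x / Z)"
proof (rule measure_eqI)
  let ?C = "emeasure M (space M)"
  fix A assume "A \<in> sets (normalize_measure (density M (\<lambda>x. k * D x)))"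
  then have A: "A \<in> sets M" by simp
  have m: "(\<lambda>x. D x * indicator A x) \<in> borel_measurable M" using A D by measurable
  have inv_C: "inverse ?C * ?C = 1"
    using C ennreal_divide_self[of ?C] by (simp add: divide_ennreal_def mult.commute top.not_eq_extremum)
  have inv_k: "inverse k * k = 1"
    using k ennreal_divide_self[of k] by (simp add: divide_ennreal_def mult.commute top.not_eq_extremum)
  have DZ: "(\<integral>\<^sup>+x. D x \<partial>M) = ?C * Z"
  proof -
    have "?C * Z = ?C * (inverse ?C * (\<integral>\<^sup>+x. D x \<partial>M))"
      using D Z(1) by (simp add: nn_integral_normalize_measure)
    also have "\<dots> = (inverse ?C * ?C) * (\<integral>\<^sup>+x. D x \<partial>M)" by (simp add: ac_simps)
    finally show ?thesis by (simp add: inv_C)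
  qed
  let ?I = "\<integral>\<^sup>+x. D x * indicator A x \<partial>M"
  have "emeasure (normalize_measure (density M (\<lambda>x. k * D x))) A
    = inverse (\<integral>\<^sup>+x. k * D x \<partial>M) * (\<integral>\<^sup>+x. k * (D x * indicator A x) \<partial>M)"
    using A D by (simp add: emeasure_normalize_measure emeasure_density mult.assoc cong: nn_integral_cong_simp)
  also have "\<dots> = inverse (k * (?C * Z)) * (k * ?I)"
    using D m by (simp add: nn_integral_cmult DZ)
  also have "inverse (k * (?C * Z)) = inverse k * (inverse ?C * inverse Z)"
    using k C Z by (simp add: ennreal_inverse_mult top.not_eq_extremum ennreal_mult_less_top)
  also have "inverse k * (inverse ?C * inverse Z) * (k * ?I) = (inverse k * k) * (inverse ?C * (inverse Z * ?I))"
    by (simp add: ac_simps)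
  also have "inverse Z * ?I = (\<integral>\<^sup>+x. D x / Z * indicator A x \<partial>M)"
    using m by (subst nn_integral_cmult[symmetric]) (simp_all add: divide_ennreal_def ac_simps)
  also have "inverse k * k * (inverse ?C * (\<integral>\<^sup>+x. D x / Z * indicator A x \<partial>M))
    = (\<integral>\<^sup>+x. D x / Z * indicator A x \<partial>normalize_measure M)"
    using A D by (subst nn_integral_normalize_measure) (simp_all add: inv_k)
  also have "\<dots> = emeasure (density (normalize_measure M) (\<lambda>x. D x / Z)) A"
    using A D by (subst emeasure_density) (simp_all add: measurable_cong_sets[OF sets_normalize_measure refl])
  finally show "emeasure (normalize_measure (density M (\<lambda>x. k * D x))) A
    = emeasure (density (normalize_measure M) (\<lambda>x. D x / Z)) A" .
qed simp

section \<open>Bounding integral differences and the bounded Lipschitz distance\<close>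

text \<open>For a density \<open>D \<ge> \<kappa>\<close> with integral \<open>1\<close>, the triangle inequality gives
  \<open>\<bar>D - 1\<bar> \<le> (D - \<kappa>) + (1 - \<kappa>)\<close>, and both summands have integral \<open>1 - \<kappa>\<close>.\<close>
lemma (in prob_space) abs_integral_density_diff_le:
  fixes D f :: "'a \<Rightarrow> real"
  assumes D: "integrable M D" "(\<integral>x. D x \<partial>M) = 1" "\<And>x. x \<in> space M \<Longrightarrow> \<kappa> \<le> D x" "0 \<le> \<kappa>"
    and f: "f \<in> borel_measurable M" "\<And>x. x \<in> space M \<Longrightarrow> \<bar>f x\<bar> \<le> 1"
  shows "\<bar>(\<integral>x. f x \<partial>density M (\<lambda>x. ennreal (D x))) - (\<integral>x. f x \<partial>M)\<bar> \<le> 2 * (1 - \<kappa>)"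
proof -
  have Dm [measurable]: "D \<in> borel_measurable M" using D(1) by simp
  note f(1) [measurable]
  have int_f: "integrable M f"
    by (rule integrable_const_bound[where B = 1]) (use f in auto)
  have int_Df: "integrable M (\<lambda>x. D x * f x)"
  proof (rule Bochner_Integration.integrable_bound[OF D(1)])
    have "norm (D x * f x) \<le> norm (D x)" if "x \<in> space M" for x
      using f(2)[OF that] by (simp add: abs_mult mult_left_le)
    then show "AE x in M. norm (D x * f x) \<le> norm (D x)" by auto
  qed measurable
  have "\<kappa> \<le> 1"
  proof -
    have "(\<integral>x. \<kappa> \<partial>M) \<le> (\<integral>x. D x \<partial>M)"
      by (rule integral_mono) (use D in auto)
    then show ?thesis using D(2) by (simp add: prob_space)
  qed
  have "(\<integral>x. f x \<partial>density M (\<lambda>x. ennreal (D x))) = (\<integral>x. D x * f x \<partial>M)"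
    using D(3,4) by (subst integral_density) (auto intro: order_trans)
  then have "\<bar>(\<integral>x. f x \<partial>density M (\<lambda>x. ennreal (D x))) - (\<integral>x. f x \<partial>M)\<bar>
    = \<bar>\<integral>x. D x * f x - f x \<partial>M\<bar>"
    using int_f int_Df by simp
  also have "\<dots> \<le> (\<integral>x. \<bar>D x * f x - f x\<bar> \<partial>M)"
    by (rule integral_abs_bound)
  also have "\<dots> \<le> (\<integral>x. (D x - \<kappa>) + (1 - \<kappa>) \<partial>M)"
  proof (rule integral_mono)
    fix x assume x: "x \<in> space M"
    have "\<bar>D x * f x - f x\<bar> = \<bar>D x - 1\<bar> * \<bar>f x\<bar>"
      by (simp add: abs_mult[symmetric] algebra_simps)
    also have "\<dots> \<le> \<bar>D x - 1\<bar>"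
      using f(2)[OF x] by (intro mult_left_le) auto
    also have "\<dots> \<le> (D x - \<kappa>) + (1 - \<kappa>)"
      using D(3)[OF x] \<open>\<kappa> \<le> 1\<close> by linarith
    finally show "\<bar>D x * f x - f x\<bar> \<le> (D x - \<kappa>) + (1 - \<kappa>)" .
  qed (use int_f int_Df D(1) in auto)
  also have "\<dots> = 2 * (1 - \<kappa>)"
    using D by (simp add: prob_space)
  finally show ?thesis .
qed

text \<open>The coupling \<open>(x, \<phi> x)\<close> of \<open>M\<close> and its image bounds the difference by the mean of
  \<open>\<bar>f x - f (\<phi> x)\<bar>\<close>, hence by its root mean square.\<close>
lemma (in prob_space) abs_integral_distr_diff_le:
  fixes f e :: "'a \<Rightarrow> real"
  assumes \<phi> [measurable]: "\<phi> \<in> measurable M M"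
    and f [measurable]: "f \<in> borel_measurable M" and f1: "\<And>x. x \<in> space M \<Longrightarrow> \<bar>f x\<bar> \<le> 1"
    and e: "\<And>x. x \<in> space M \<Longrightarrow> \<bar>f x - f (\<phi> x)\<bar> \<le> e x"
    and v: "(\<integral>\<^sup>+x. ennreal ((e x)\<^sup>2) \<partial>M) \<le> ennreal v" "0 \<le> v"
  shows "\<bar>(\<integral>x. f x \<partial>M) - (\<integral>x. f x \<partial>distr M M \<phi>)\<bar> \<le> sqrt v"
proof -
  let ?g = "\<lambda>x. f x - f (\<phi> x)"
  have f1': "\<bar>f (\<phi> x)\<bar> \<le> 1" if "x \<in> space M" for x
    using f1 measurable_space[OF \<phi> that] by auto
  have int: "integrable M f" "integrable M (\<lambda>x. f (\<phi> x))"
    by (rule integrable_const_bound[where B = 1]; use f1 f1' in auto)+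
  then have int_g: "integrable M ?g" by simp
  have g2: "\<bar>?g x\<bar> \<le> 2" if "x \<in> space M" for x
    using f1[OF that] f1'[OF that] by linarith
  have int_g2: "integrable M (\<lambda>x. (?g x)\<^sup>2)"
  proof (rule integrable_const_bound[where B = 4])
    have "(?g x)\<^sup>2 \<le> 4" if "x \<in> space M" for x
      using power_mono[OF g2[OF that], of 2] by simp
    then show "AE x in M. norm ((?g x)\<^sup>2) \<le> 4" by auto
  qed measurable
  have "ennreal (\<integral>x. (?g x)\<^sup>2 \<partial>M) = (\<integral>\<^sup>+x. ennreal ((?g x)\<^sup>2) \<partial>M)"
    by (rule nn_integral_eq_integral[symmetric, OF int_g2]) simp
  also have "\<dots> \<le> (\<integral>\<^sup>+x. ennreal ((e x)\<^sup>2) \<partial>M)"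
    using e by (intro nn_integral_mono ennreal_leI) (metis abs_ge_zero power2_abs power_mono)
  also note v(1)
  finally have "(\<integral>x. (?g x)\<^sup>2 \<partial>M) \<le> v" using v(2) by simp
  moreover have "0 \<le> expectation (\<lambda>x. (?g x)\<^sup>2) - (expectation ?g)\<^sup>2"
    using variance_positive[of ?g] variance_eq[OF int_g int_g2] by simp
  ultimately have "\<bar>expectation ?g\<bar> \<le> sqrt v"
    by (intro real_le_rsqrt) (simp add: power2_abs)
  then show ?thesis
    using int by (simp add: integral_distr)
qed

text \<open>A test function in the definition has sup-norm plus Lipschitz constant at most \<open>1\<close>, so each of
  the two is at most \<open>1\<close>. The Lipschitz constant is an infimum, which explains the detour through
  an arbitrarily small excess \<open>\<eta>\<close>.\<close>
lemma d_beta_le: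
  assumes sp: "space M = X" "space N = X" "X \<noteq> {}" and D: "\<And>x y. 0 \<le> D x y"
    and le: "\<And>f. f \<in> borel_measurable M \<Longrightarrow> f \<in> borel_measurable N \<Longrightarrow>
      (\<And>x. x \<in> X \<Longrightarrow> \<bar>f x\<bar> \<le> 1) \<Longrightarrow>
      (\<And>x y. x \<in> X \<Longrightarrow> y \<in> X \<Longrightarrow> \<bar>f x - f y\<bar> \<le> D x y) \<Longrightarrow>
      \<bar>(\<integral>x. f x \<partial>M) - (\<integral>x. f x \<partial>N)\<bar> \<le> b"
  shows "d_beta D M N \<le> ereal b"
  unfolding d_beta_def
proof (rule SUP_least, safe)
  fix f assume f: "f \<in> borel_measurable M" "f \<in> borel_measurable N"
    and le1: "sup_norm_on (space M) f + lip_const_on (space M) D f \<le> 1"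
  have s0: "0 \<le> sup_norm_on X f"
    using sp(3) unfolding sup_norm_on_def by (auto intro: SUP_upper2)
  have l0: "0 \<le> lip_const_on X D f"
    unfolding lip_const_on_def by (rule Inf_greatest) auto
  have s1: "sup_norm_on X f \<le> 1" and l1: "lip_const_on X D f \<le> 1"
    using le1 s0 l0 sp add_increasing2[OF l0 order_refl, of "sup_norm_on X f"]
      add_increasing[OF s0 order_refl, of "lip_const_on X D f"] by (auto intro: order_trans)
  have "\<bar>f x\<bar> \<le> 1" if "x \<in> X" for x
  proof -
    have "ereal \<bar>f x\<bar> \<le> sup_norm_on X f"
      unfolding sup_norm_on_def using that by (rule SUP_upper)
    with s1 have "ereal \<bar>f x\<bar> \<le> 1" by (rule order_trans[rotated])
    then show ?thesis by simp
  qed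
  moreover have "\<bar>f x - f y\<bar> \<le> D x y" if xy: "x \<in> X" "y \<in> X" for x y
  proof (rule field_le_epsilon)
    fix \<epsilon> :: real assume \<epsilon>: "0 < \<epsilon>"
    define \<eta> where "\<eta> = \<epsilon> / (D x y + 1)"
    have \<eta>: "0 < \<eta>" using \<epsilon> D[of x y] by (simp add: \<eta>_def)
    have "lip_const_on X D f < ereal (1 + \<eta>)"
      using \<eta> by (intro le_less_trans[OF l1]) (simp add: one_ereal_def)
    then obtain L where L: "L < 1 + \<eta>" "\<forall>x\<in>X. \<forall>y\<in>X. \<bar>f x - f y\<bar> \<le> L * D x y"
      unfolding lip_const_on_def Inf_less_iff by auto
    have "\<bar>f x - f y\<bar> \<le> L * D x y" using L(2) xy by auto
    also have "\<dots> \<le> (1 + \<eta>) * D x y" using L(1) D by (intro mult_right_mono) auto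
    also have "\<dots> \<le> D x y + \<epsilon>"
      using \<epsilon> D[of x y] by (simp add: \<eta>_def field_simps)
    finally show "\<bar>f x - f y\<bar> \<le> D x y + \<epsilon>" .
  qed
  ultimately show "ereal \<bar>(\<integral>x. f x \<partial>M) - (\<integral>x. f x \<partial>N)\<bar> \<le> ereal b"
    using le f by simp
qed

section \<open>Gaussian smoothing of the inactive coordinates\<close>

text \<open>The density of the centred Gaussian with covariance \<open>\<gamma> I\<close> on the coordinates outside the
  model \<open>\<delta>\<close>, in the form in which it occurs in \<open>posterior_tilde\<close>.\<close>
definition orth_gauss :: "real \<Rightarrow> real ^ 'n \<Rightarrow> real ^ 'n \<Rightarrow> real" where
  "orth_gauss \<gamma> \<delta> \<theta> = (1 / (2 * pi * \<gamma>)) powr ((real CARD('n) - real (norm0 \<delta>)) / 2) *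
     exp (- (1 / (2 * \<gamma>)) * (norm (\<theta> - \<theta> * \<delta>))\<^sup>2)"

lemma orth_gauss_nonneg [simp]: "0 \<le> orth_gauss \<gamma> \<delta> \<theta>"
  by (simp add: orth_gauss_def)

lemma codim_eq_card:
  fixes \<delta> :: "real ^ 'n"
  shows "real CARD('n) - real (norm0 \<delta>) = real (card {j. \<delta> $ j = 0})"
proof -
  have "card (UNIV :: 'n set) = card ({j. \<delta> $ j = 0} \<union> {j. \<delta> $ j \<noteq> 0})"
    by (rule arg_cong[where f = card]) auto
  also have "\<dots> = card {j. \<delta> $ j = 0} + norm0 \<delta>"
    unfolding norm0_def by (rule card_Un_disjoint) auto
  finally show ?thesis by simp
qed

lemma norm_diff_Delta:
  fixes \<delta> \<theta> :: "real ^ 'n"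
  assumes "\<delta> \<in> Delta"
  shows "(norm (\<theta> - \<theta> * \<delta>))\<^sup>2 = (\<Sum>j | \<delta> $ j = 0. (\<theta> $ j)\<^sup>2)"
proof -
  have "(norm (\<theta> - \<theta> * \<delta>))\<^sup>2 = (\<Sum>j\<in>UNIV. (\<theta> $ j - \<theta> $ j * \<delta> $ j)\<^sup>2)"
    unfolding power2_norm_eq_inner inner_vec_def by (simp add: power2_eq_square)
  also have "\<dots> = (\<Sum>j\<in>UNIV. if \<delta> $ j = 0 then (\<theta> $ j)\<^sup>2 else 0)"
    using assms by (intro sum.cong) (auto simp: Delta_def split: if_splits)
  also have "\<dots> = (\<Sum>j | \<delta> $ j = 0. (\<theta> $ j)\<^sup>2)"
    by (simp add: sum.If_cases)
  finally show ?thesis .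
qed

lemma orth_gauss_eq_prod:
  fixes \<delta> \<theta> :: "real ^ 'n"
  assumes \<gamma>: "0 < \<gamma>" and \<delta>: "\<delta> \<in> Delta"
  shows "orth_gauss \<gamma> \<delta> \<theta> = (\<Prod>j | \<delta> $ j = 0. normal_density 0 (sqrt \<gamma>) (\<theta> $ j))"
proof -
  let ?c = "1 / (2 * pi * \<gamma>)" and ?J = "{j. \<delta> $ j = 0}"
  have c: "0 < ?c" using \<gamma> by simp
  have "?c powr (real (card ?J) / 2) = (?c powr (1 / 2)) powr real (card ?J)"
    by (simp add: powr_powr)
  also have "\<dots> = (1 / sqrt (2 * pi * \<gamma>)) ^ card ?J"
    using \<gamma> by (subst powr_realpow) (auto simp: powr_half_sqrt real_sqrt_divide)
  finally have 1: "?c powr (real (card ?J) / 2) = (\<Prod>j\<in>?J. 1 / sqrt (2 * pi * \<gamma>))" by simp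
  have 2: "exp (- (1 / (2 * \<gamma>)) * (norm (\<theta> - \<theta> * \<delta>))\<^sup>2) = (\<Prod>j\<in>?J. exp (- (\<theta> $ j)\<^sup>2 / (2 * \<gamma>)))"
    by (simp add: norm_diff_Delta[OF \<delta>] sum_distrib_left exp_sum)
  show ?thesis
    using \<gamma> unfolding orth_gauss_def codim_eq_card 1 2 prod.distrib[symmetric]
    by (simp add: normal_density_def)
qed

lemma borel_measurable_times_Delta [measurable (raw)]:
  fixes f g :: "'a \<Rightarrow> real ^ 'n"
  assumes "f \<in> borel_measurable M" "g \<in> borel_measurable M"
  shows "(\<lambda>x. f x * g x) \<in> borel_measurable M"
  using borel_measurable_vec_lambda[of "\<lambda>x j. f x $ j * g x $ j" M] assms
  by (simp add: times_vec_def)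

lemma borel_measurable_orth_gauss [measurable]: "orth_gauss \<gamma> \<delta> \<in> borel_measurable borel"
  unfolding orth_gauss_def by measurable

lemma nn_integral_normal_density:
  assumes "0 < \<gamma>"
  shows "(\<integral>\<^sup>+x. ennreal (normal_density 0 (sqrt \<gamma>) x) \<partial>lborel) = 1"
  using assms by (subst nn_integral_eq_integral) auto

lemma nn_integral_orth_gauss:
  fixes \<delta> :: "real ^ 'n"
  assumes \<gamma>: "0 < \<gamma>" and \<delta>: "\<delta> \<in> Delta" and F: "F \<in> borel_measurable borel"
  shows "(\<integral>\<^sup>+\<theta>. ennreal (orth_gauss \<gamma> \<delta> \<theta>) * F (\<theta> * \<delta>) \<partial>lborel) = (\<integral>\<^sup>+\<theta>. F \<theta> \<partial>mu \<delta>)"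
  using nn_integral_mu_eq_lborel[of \<delta> "\<lambda>_ x. ennreal (normal_density 0 (sqrt \<gamma>) x)" F]
  by (simp add: orth_gauss_eq_prod[OF \<gamma> \<delta>] prod_ennreal \<delta> F nn_integral_normal_density[OF \<gamma>])

text \<open>Multiplying a centred Gaussian of variance \<open>\<gamma>\<close> by \<open>exp (a x\<^sup>2)\<close> gives, up to a constant, the
  centred Gaussian of variance \<open>\<gamma> / (1 - 2 a \<gamma>)\<close>, so that the integral reduces to the one without
  exponential factor.\<close>
lemma nn_integral_orth_gauss_exp_sq:
  fixes \<delta> :: "real ^ 'n"
  assumes \<gamma>: "0 < \<gamma>" and a: "2 * a * \<gamma> < 1" and \<delta>: "\<delta> \<in> Delta" and F [measurable]: "F \<in> borel_measurable borel"
  shows "(\<integral>\<^sup>+\<theta>. ennreal (orth_gauss \<gamma> \<delta> \<theta> * exp (a * (norm (\<theta> - \<theta> * \<delta>))\<^sup>2)) * F (\<theta> * \<delta>) \<partial>lborel)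
    = ennreal ((1 / (1 - 2 * a * \<gamma>)) powr (real (card {j. \<delta> $ j = 0}) / 2)) * (\<integral>\<^sup>+\<theta>. F \<theta> \<partial>mu \<delta>)"
proof -
  \<comment> \<open>The variance of the reweighted Gaussian.\<close>
  define \<gamma>' where "\<gamma>' = \<gamma> / (1 - 2 * a * \<gamma>)"
  have \<gamma>': "0 < \<gamma>'" using \<gamma> a by (simp add: \<gamma>'_def)
  let ?c = "(1 / (1 - 2 * a * \<gamma>)) powr (real (card {j. \<delta> $ j = 0}) / 2)"
  have eq: "orth_gauss \<gamma> \<delta> \<theta> * exp (a * (norm (\<theta> - \<theta> * \<delta>))\<^sup>2) = ?c * orth_gauss \<gamma>' \<delta> \<theta>" for \<theta>
  proof -
    have "1 / (2 * pi * \<gamma>) = (1 / (1 - 2 * a * \<gamma>)) * (1 / (2 * pi * \<gamma>'))"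
      using \<gamma> a by (simp add: \<gamma>'_def)
    then have "(1 / (2 * pi * \<gamma>)) powr b = (1 / (1 - 2 * a * \<gamma>)) powr b * (1 / (2 * pi * \<gamma>')) powr b" for b
      by (simp only: powr_mult)
    moreover have "- (1 / (2 * \<gamma>)) + a = - (1 / (2 * \<gamma>'))"
      using \<gamma> a by (simp add: \<gamma>'_def field_simps)
    then have "exp (- (1 / (2 * \<gamma>)) * x) * exp (a * x) = exp (- (1 / (2 * \<gamma>')) * x)" for x
      by (simp only: exp_add[symmetric] distrib_right[symmetric])
    ultimately show ?thesis
      unfolding orth_gauss_def codim_eq_card by (simp only: mult.assoc)
  qed
  have "(\<integral>\<^sup>+\<theta>. ennreal (orth_gauss \<gamma> \<delta> \<theta> * exp (a * (norm (\<theta> - \<theta> * \<delta>))\<^sup>2)) * F (\<theta> * \<delta>) \<partial>lborel)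
    = (\<integral>\<^sup>+\<theta>. ennreal ?c * (ennreal (orth_gauss \<gamma>' \<delta> \<theta>) * F (\<theta> * \<delta>)) \<partial>lborel)"
    unfolding eq by (simp add: ennreal_mult' mult.assoc)
  also have "\<dots> = ennreal ?c * (\<integral>\<^sup>+\<theta>. ennreal (orth_gauss \<gamma>' \<delta> \<theta>) * F (\<theta> * \<delta>) \<partial>lborel)"
    by (rule nn_integral_cmult) measurable
  finally show ?thesis by (simp add: nn_integral_orth_gauss[OF \<gamma>' \<delta> F])
qed

lemma nn_integral_normal_density_sq:
  assumes "0 < \<gamma>"
  shows "(\<integral>\<^sup>+x. ennreal (normal_density 0 (sqrt \<gamma>) x * x\<^sup>2) \<partial>lborel) = ennreal \<gamma>"
proof -
  have "has_bochner_integral lborel (\<lambda>x. normal_density 0 (sqrt \<gamma>) x * x\<^sup>2) \<gamma>"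
    using normal_moment_even[of "sqrt \<gamma>" 0 1] assms by (simp add: fact_2)
  then show ?thesis
    by (simp add: nn_integral_eq_integral has_bochner_integral_iff)
qed

text \<open>The square of the norm is the sum of the squared inactive coordinates. For each such coordinate
  \<open>i\<close>, the function \<open>x\<^sup>2 normal_density 0 (sqrt \<gamma>) x / \<gamma>\<close> is again a probability density, which can
  take the place of the Gaussian in that coordinate.\<close>
lemma nn_integral_orth_gauss_sq:
  fixes \<delta> :: "real ^ 'n"
  assumes \<gamma>: "0 < \<gamma>" and \<delta>: "\<delta> \<in> Delta" and F [measurable]: "F \<in> borel_measurable borel"
  shows "(\<integral>\<^sup>+\<theta>. ennreal (orth_gauss \<gamma> \<delta> \<theta> * (norm (\<theta> - \<theta> * \<delta>))\<^sup>2) * F (\<theta> * \<delta>) \<partial>lborel)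
    = ennreal (\<gamma> * real (card {j. \<delta> $ j = 0})) * (\<integral>\<^sup>+\<theta>. F \<theta> \<partial>mu \<delta>)"
proof -
  let ?J = "{j. \<delta> $ j = 0}"
  let ?q = "\<lambda>i j x. ennreal (if j = i then normal_density 0 (sqrt \<gamma>) x * x\<^sup>2 / \<gamma> else normal_density 0 (sqrt \<gamma>) x)"
  have one: "(\<integral>\<^sup>+\<theta>. ennreal (orth_gauss \<gamma> \<delta> \<theta> * (\<theta> $ i)\<^sup>2) * F (\<theta> * \<delta>) \<partial>lborel) = ennreal \<gamma> * (\<integral>\<^sup>+\<theta>. F \<theta> \<partial>mu \<delta>)"
    if i: "i \<in> ?J" for i
  proof -
    have "ennreal (orth_gauss \<gamma> \<delta> \<theta> * (\<theta> $ i)\<^sup>2) = ennreal \<gamma> * (\<Prod>j\<in>?J. ?q i j (\<theta> $ j))" for \<theta>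
    proof -
      have "(\<Prod>j\<in>?J. if j = i then normal_density 0 (sqrt \<gamma>) (\<theta> $ j) * (\<theta> $ j)\<^sup>2 / \<gamma> else normal_density 0 (sqrt \<gamma>) (\<theta> $ j))
        = (\<Prod>j\<in>?J. normal_density 0 (sqrt \<gamma>) (\<theta> $ j)) * (\<theta> $ i)\<^sup>2 / \<gamma>"
        using i by (subst (1 2) prod.remove[of _ i]) (auto intro!: prod.cong)
      then show ?thesis
        using \<gamma> by (simp add: prod_ennreal orth_gauss_eq_prod[OF \<gamma> \<delta>] ennreal_mult''[symmetric] prod_nonneg)
    qed
    then have "(\<integral>\<^sup>+\<theta>. ennreal (orth_gauss \<gamma> \<delta> \<theta> * (\<theta> $ i)\<^sup>2) * F (\<theta> * \<delta>) \<partial>lborel)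
      = (\<integral>\<^sup>+\<theta>. ennreal \<gamma> * ((\<Prod>j\<in>?J. ?q i j (\<theta> $ j)) * F (\<theta> * \<delta>)) \<partial>lborel)"
      by (simp add: mult.assoc)
    also have "\<dots> = ennreal \<gamma> * (\<integral>\<^sup>+\<theta>. (\<Prod>j\<in>?J. ?q i j (\<theta> $ j)) * F (\<theta> * \<delta>) \<partial>lborel)"
      by (rule nn_integral_cmult) measurable
    also have "(\<integral>\<^sup>+\<theta>. (\<Prod>j\<in>?J. ?q i j (\<theta> $ j)) * F (\<theta> * \<delta>) \<partial>lborel) = (\<integral>\<^sup>+\<theta>. F \<theta> \<partial>mu \<delta>)"
    proof (rule nn_integral_mu_eq_lborel[OF \<delta> _ _ F])
      fix j
      have "(\<integral>\<^sup>+x. ennreal (normal_density 0 (sqrt \<gamma>) x * x\<^sup>2 / \<gamma>) \<partial>lborel)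
        = (\<integral>\<^sup>+x. ennreal (normal_density 0 (sqrt \<gamma>) x * x\<^sup>2) \<partial>lborel) / ennreal \<gamma>"
        using \<gamma> by (simp add: divide_ennreal[symmetric] nn_integral_divide)
      also have "\<dots> = 1" using \<gamma> by (simp add: nn_integral_normal_density_sq divide_ennreal)
      finally show "(\<integral>\<^sup>+x. ?q i j x \<partial>lborel) = 1"
        using \<gamma> by (cases "j = i") (simp_all add: nn_integral_normal_density)
    qed measurable
    finally show ?thesis .
  qed
  have "(\<integral>\<^sup>+\<theta>. ennreal (orth_gauss \<gamma> \<delta> \<theta> * (norm (\<theta> - \<theta> * \<delta>))\<^sup>2) * F (\<theta> * \<delta>) \<partial>lborel)
    = (\<integral>\<^sup>+\<theta>. (\<Sum>i\<in>?J. ennreal (orth_gauss \<gamma> \<delta> \<theta> * (\<theta> $ i)\<^sup>2) * F (\<theta> * \<delta>)) \<partial>lborel)"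
    by (simp add: norm_diff_Delta[OF \<delta>] sum_distrib_left sum_distrib_right[symmetric])
  also have "\<dots> = (\<Sum>i\<in>?J. \<integral>\<^sup>+\<theta>. ennreal (orth_gauss \<gamma> \<delta> \<theta> * (\<theta> $ i)\<^sup>2) * F (\<theta> * \<delta>) \<partial>lborel)"
    by (rule nn_integral_sum) measurable
  also have "\<dots> = of_nat (card ?J) * (ennreal \<gamma> * (\<integral>\<^sup>+\<theta>. F \<theta> \<partial>mu \<delta>))"
    by (simp add: one)
  also have "\<dots> = ennreal (\<gamma> * real (card ?J)) * (\<integral>\<^sup>+\<theta>. F \<theta> \<partial>mu \<delta>)"
    using \<gamma> by (simp add: ennreal_mult' ennreal_of_nat_eq_real_of_nat ac_simps)
  finally show ?thesis .
qed

section \<open>Elementary inequalities\<close>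

lemma GDERIV_unique:
  assumes "GDERIV f x :> D" "GDERIV f x :> D'"
  shows "D = D'"
proof -
  have "(\<lambda>h. inner h D) = (\<lambda>h. inner h D')"
    using has_derivative_unique assms unfolding gderiv_def by blast
  then show ?thesis by (metis inner_commute vector_eq_ldot)
qed

lemma GDERIV_grad: "GDERIV f x :> D \<Longrightarrow> GDERIV f x :> grad f x"
  unfolding grad_def by (rule theI[of _ D]) (auto intro: GDERIV_unique)

text \<open>The one-dimensional tangent inequality along the segment from \<open>x\<close> to \<open>y\<close>.\<close>
lemma convex_above_gradient:
  fixes f :: "'a::real_inner \<Rightarrow> real"
  assumes f: "convex_on UNIV f" and D: "GDERIV f x :> D"
  shows "f x + D \<bullet> (y - x) \<le> f y"
proof -
  let ?\<phi> = "\<lambda>t. f (x + t *\<^sub>R (y - x))"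
  have conv: "convex_on UNIV ?\<phi>"
  proof (rule convex_onI)
    fix t a b :: real assume t: "0 < t" "t < 1"
    have "x + ((1 - t) * a + t * b) *\<^sub>R (y - x)
      = (1 - t) *\<^sub>R (x + a *\<^sub>R (y - x)) + t *\<^sub>R (x + b *\<^sub>R (y - x))"
      by (simp add: algebra_simps)
    then show "?\<phi> ((1 - t) *\<^sub>R a + t *\<^sub>R b) \<le> (1 - t) * ?\<phi> a + t * ?\<phi> b"
      using convex_onD[OF f, of t "x + a *\<^sub>R (y - x)" "x + b *\<^sub>R (y - x)"] t by simp
  qed simp
  have "((\<lambda>t. x + t *\<^sub>R (y - x)) has_derivative (\<lambda>t. t *\<^sub>R (y - x))) (at 0)"
    by (auto intro!: derivative_eq_intros)
  from has_derivative_compose[OF this, of f "\<lambda>h. inner h D"]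
  have "(?\<phi> has_derivative (\<lambda>t. (t *\<^sub>R (y - x)) \<bullet> D)) (at 0)"
    using D by (simp add: gderiv_def)
  then have "(?\<phi> has_field_derivative D \<bullet> (y - x)) (at 0)"
    unfolding has_field_derivative_def by (simp add: inner_commute mult_commute_abs)
  then have "(D \<bullet> (y - x)) * (1 - 0) \<le> ?\<phi> 1 - ?\<phi> 0"
    using convex_on_imp_above_tangent[OF conv, of 0 1 "D \<bullet> (y - x)"] by simp
  then show ?thesis by simp
qed

text \<open>The bound \<open>1 / (1 - t) \<le> exp (2 t)\<close> turns both a Gaussian exponential moment and a Jacobian
  into exponentials. It already fails at \<open>t = 4/5\<close>. The quadratic Taylor polynomial of \<open>exp t\<close>,
  squared, is just precise enough on this interval.\<close>
lemma one_le_exp_mult: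
  fixes t :: real
  assumes "0 \<le> t" "t \<le> 3 / 4"
  shows "1 \<le> exp (2 * t) * (1 - t)"
proof -
  let ?q = "1 + t + t\<^sup>2 / 2"
  have "t^2 \<le> (3/4)^2" "t^3 \<le> (3/4)^3" "t^4 \<le> (3/4)^4"
    using assms by (simp_all add: power_mono)
  then have "0 \<le> 1 - t^2 - 3/4 * t^3 - 1/4 * t^4" by (simp add: power_divide)
  then have "0 \<le> t * (1 - t^2 - 3/4 * t^3 - 1/4 * t^4)" using assms by simp
  also have "\<dots> = ?q^2 * (1 - t) - 1"
    by (simp add: power2_eq_square power3_eq_cube power4_eq_xxxx field_simps)
  also have "?q^2 \<le> (exp t)^2"
    using assms exp_lower_Taylor_quadratic[of t] by (intro power_mono) auto
  then have "?q^2 * (1 - t) - 1 \<le> exp (2 * t) * (1 - t) - 1"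
    using assms by (simp add: exp_double mult_right_mono)
  finally show ?thesis by simp
qed

section \<open>Sparse vectors and the log-posterior\<close>

lemma R_sparse_times [simp]: "\<theta> * \<delta> \<in> R_sparse \<delta>"
  by (simp add: R_sparse_def)

lemma times_Delta_idem: "\<delta> \<in> Delta \<Longrightarrow> \<theta> * \<delta> * \<delta> = \<theta> * \<delta>"
  by (force simp: vec_eq_iff Delta_def)

lemma R_sparse_iff: "\<delta> \<in> Delta \<Longrightarrow> \<theta> \<in> R_sparse \<delta> \<longleftrightarrow> \<theta> * \<delta> = \<theta>"
  by (force simp: vec_eq_iff Delta_def R_sparse_def)

lemma pen_sparse:
  "\<theta> \<in> R_sparse \<delta> \<Longrightarrow> pen p \<theta> \<delta> = ereal (- (\<Sum>j | \<delta> $ j = 1. ln (p (\<theta> $ j))))"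
  by (simp add: pen_def)

lemma inner_sparse:
  assumes "v \<in> R_sparse \<delta>" "\<delta> \<in> Delta"
  shows "a \<bullet> v = (\<delta> * a) \<bullet> v"
  unfolding inner_vec_def
proof (rule sum.cong[OF refl])
  fix j
  have "\<delta> $ j = 0 \<or> \<delta> $ j = 1" using assms(2) by (auto simp: Delta_def)
  then show "a $ j \<bullet> v $ j = (\<delta> * a) $ j \<bullet> v $ j"
    using assms(1) by (auto simp: R_sparse_def)
qed

lemma inner_sparse_complement:
  assumes "v \<in> R_sparse \<delta>" "\<delta> \<in> Delta"
  shows "v \<bullet> (\<theta> - \<theta> * \<delta>) = 0"
  unfolding inner_vec_def
proof (rule sum.neutral, rule ballI)
  fix j
  have "\<delta> $ j = 0 \<or> \<delta> $ j = 1" using assms(2) by (auto simp: Delta_def)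
  then show "v $ j \<bullet> (\<theta> - \<theta> * \<delta>) $ j = 0"
    using assms(1) by (auto simp: R_sparse_def)
qed

text \<open>The finite part of \<open>h_post\<close>, extended to all of \<open>real ^ 'n\<close> so as to depend on the active coordinates
  only. This avoids the value \<open>\<infinity>\<close> off the sparse subspace in all integrals.\<close>
definition neg_log_post :: "(real ^ 'n \<Rightarrow> real) \<Rightarrow> (real \<Rightarrow> real) \<Rightarrow> real ^ 'n \<Rightarrow> real ^ 'n \<Rightarrow> real" where
  "neg_log_post l p \<delta> \<theta> = l (\<theta> * \<delta>) - (\<Sum>j | \<delta> $ j = 1. ln (p (\<theta> $ j)))"

lemma h_post_times: "h_post l p (\<theta> * \<delta>) \<delta> = ereal (neg_log_post l p \<delta> \<theta>)"
proof -
  have "(\<Sum>j | \<delta> $ j = 1. ln (p ((\<theta> * \<delta>) $ j))) = (\<Sum>j | \<delta> $ j = 1. ln (p (\<theta> $ j)))"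
    by (rule sum.cong) auto
  then show ?thesis by (simp add: h_post_def pen_sparse neg_log_post_def)
qed

lemma neg_log_post_times: "\<delta> \<in> Delta \<Longrightarrow> neg_log_post l p \<delta> (\<theta> * \<delta>) = neg_log_post l p \<delta> \<theta>"
  using h_post_times[of l p "\<theta> * \<delta>" \<delta>] h_post_times[of l p \<theta> \<delta>] by (simp add: times_Delta_idem)

lemma eexp_ereal [simp]: "eexp (ereal x) = ennreal (exp x)"
  by (simp add: eexp_def)

text \<open>Completing the square.\<close>
lemma norm_sq_lower:
  fixes G v :: "'a::real_inner"
  assumes "0 < \<gamma>"
  shows "- (\<gamma> / 2 * (norm G)\<^sup>2) \<le> G \<bullet> v + 1 / (2 * \<gamma>) * (norm v)\<^sup>2"
proof -
  have "0 \<le> (norm (v + \<gamma> *\<^sub>R G))\<^sup>2 / (2 * \<gamma>)" using assms by simp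
  also have "\<dots> = G \<bullet> v + 1 / (2 * \<gamma>) * (norm v)\<^sup>2 + \<gamma> / 2 * (norm G)\<^sup>2"
    using assms unfolding power2_norm_eq_inner
    by (simp add: inner_add_left inner_add_right inner_commute field_simps power2_eq_square)
  finally show ?thesis by linarith
qed

lemma norm_sq_add3_le:
  fixes a b c :: "'a::real_inner"
  shows "(norm (a + b + c))\<^sup>2 \<le> 3 * ((norm a)\<^sup>2 + (norm b)\<^sup>2 + (norm c)\<^sup>2)"
proof -
  have "0 \<le> (norm (a - b))\<^sup>2 + (norm (b - c))\<^sup>2 + (norm (a - c))\<^sup>2" by simp
  then show ?thesis
    unfolding power2_norm_eq_inner
    by (simp add: inner_add_left inner_add_right inner_diff_left inner_diff_right inner_commute)
qed

text \<open>The negative log-likelihood becomes an arbitrary convex function \<open>l\<close> with gradient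
  \<open>grad l\<close>, so that the data no longer appear.\<close>
locale sparse_model =
  fixes l :: "real ^ 'n \<Rightarrow> real" and w :: "real ^ 'n \<Rightarrow> real" and p :: "real \<Rightarrow> real"
    and g :: "real ^ 'n \<Rightarrow> real ^ 'n \<Rightarrow> real ^ 'n" and c :: "real ^ 'n \<Rightarrow> real"
    and L1 L2 \<gamma> :: real
  assumes w_nonneg: "\<And>\<delta>. \<delta> \<in> Delta \<Longrightarrow> 0 \<le> w \<delta>" and w_sum: "(\<Sum>\<delta>\<in>Delta. w \<delta>) = 1"
    and p_meas [measurable]: "p \<in> borel_measurable borel" and p_pos: "\<And>x. 0 < p x"
    and p_int: "(\<integral>\<^sup>+x. ennreal (p x) \<partial>lborel) = 1"
    and l_convex: "convex_on UNIV l"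
    and l_grad: "\<And>x. GDERIV l x :> grad l x"
    and P_convex: "\<And>\<delta>. \<delta> \<in> Delta \<Longrightarrow> ereal_convex (\<lambda>\<theta> :: real ^ 'n. pen p \<theta> \<delta>)"
    and P_subgradient: "\<And>\<delta> \<theta>. \<delta> \<in> Delta \<Longrightarrow> \<theta> \<in> R_sparse \<delta> \<Longrightarrow>
      is_subgradient (\<lambda>u. pen p u \<delta>) (g \<theta> \<delta>) \<theta>"
    and L_nonneg: "0 \<le> L1" "0 \<le> L2"
    and grad_lipschitz: "\<And>\<theta>1 \<theta>2. norm (grad l \<theta>1 - grad l \<theta>2) \<le> L1 * norm (\<theta>1 - \<theta>2)"
    and grad_bound: "\<And>\<delta> \<theta>. \<delta> \<in> Delta \<Longrightarrow> \<theta> \<in> R_sparse \<delta> \<Longrightarrow>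
      (norm (\<delta> * grad l \<theta>))\<^sup>2 \<le> 2 * L2 * l \<theta>"
    and subgrad_bound: "\<And>\<delta> \<theta>. \<delta> \<in> Delta \<Longrightarrow> \<theta> \<in> R_sparse \<delta> \<Longrightarrow>
      ereal ((norm (\<delta> * g \<theta> \<delta>))\<^sup>2) \<le> ereal (c \<delta>) + ereal (2 * L2) * pen p \<theta> \<delta>"
    and gamma_pos: "0 < \<gamma>" and gamma_le: "4 * \<gamma> * max L1 L2 \<le> 1"
begin

abbreviation "H \<equiv> neg_log_post l p"

lemma gamma_L: "\<gamma> * L1 \<le> 1 / 4" "\<gamma> * L2 \<le> 1 / 4"
proof -
  have "4 * \<gamma> * L1 \<le> 4 * \<gamma> * max L1 L2" "4 * \<gamma> * L2 \<le> 4 * \<gamma> * max L1 L2"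
    using gamma_pos by (simp_all add: mult_left_mono)
  then show "\<gamma> * L1 \<le> 1 / 4" "\<gamma> * L2 \<le> 1 / 4" using gamma_le by linarith+
qed

lemma l_tangent: "l x + grad l x \<bullet> (y - x) \<le> l y"
  by (rule convex_above_gradient[OF l_convex l_grad])

lemma continuous_l: "continuous_on S l"
  using l_grad unfolding gderiv_def
  by (meson continuous_at_imp_continuous_on has_derivative_continuous)

lemma continuous_grad: "continuous_on S (grad l)"
proof (rule continuous_on_subset)
  have "L1-lipschitz_on UNIV (grad l)"
    using grad_lipschitz L_nonneg by (auto intro: lipschitz_onI simp: dist_norm)
  then show "continuous_on UNIV (grad l)" by (rule lipschitz_on_continuous_on)
qed simp

lemma borel_l [measurable]: "l \<in> borel_measurable borel"
  by (rule borel_measurable_continuous_onI[OF continuous_l])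

lemma borel_H [measurable]: "H \<delta> \<in> borel_measurable borel"
  unfolding neg_log_post_def by measurable

text \<open>For \<open>L2 > 0\<close> the gradient bound for the full model forces \<open>l \<ge> 0\<close>. For \<open>L2 = 0\<close> it forces the
  gradient to vanish, and a critical point of a convex function is a minimum.\<close>
lemma l_bounded_below: "\<exists>m. \<forall>\<theta>. m \<le> l \<theta>"
proof (cases "L2 = 0")
  case True
  have "(norm (1 * grad l 0))\<^sup>2 \<le> 2 * L2 * l 0"
    using one_in_Delta by (rule grad_bound) (simp add: R_sparse_def)
  then have "grad l 0 = 0" using True by simp
  then show ?thesis using l_tangent[of 0] by auto
next
  case False
  have "0 \<le> l \<theta>" for \<theta>
  proof -
    have "0 \<le> (norm (1 * grad l \<theta>))\<^sup>2" by simp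
    also have "\<dots> \<le> 2 * L2 * l \<theta>"
      using one_in_Delta by (rule grad_bound) (simp add: R_sparse_def)
    finally show ?thesis using False L_nonneg by (simp add: zero_le_mult_iff)
  qed
  then show ?thesis by blast
qed

lemma exp_H: "exp (- H \<delta> \<theta>) = exp (- l (\<theta> * \<delta>)) * (\<Prod>j | \<delta> $ j = 1. p (\<theta> $ j))"
  using p_pos by (simp add: neg_log_post_def exp_diff exp_minus exp_sum field_simps)

lemma H_convex:
  assumes \<delta>: "\<delta> \<in> Delta" and t: "0 \<le> t" "t \<le> 1"
  shows "H \<delta> ((1 - t) *\<^sub>R x + t *\<^sub>R y) \<le> (1 - t) * H \<delta> x + t * H \<delta> y"
proof -
  let ?z = "(1 - t) *\<^sub>R x + t *\<^sub>R y"
  have z: "?z * \<delta> = (1 - t) *\<^sub>R (x * \<delta>) + t *\<^sub>R (y * \<delta>)"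
    by (simp add: vec_eq_iff algebra_simps)
  have pen_eq: "pen p (u * \<delta>) \<delta> = ereal (- (\<Sum>j | \<delta> $ j = 1. ln (p (u $ j))))" for u :: "real ^ 'n"
    by (simp add: pen_sparse)
  have "pen p (?z * \<delta>) \<delta> \<le> ereal (1 - t) * pen p (x * \<delta>) \<delta> + ereal t * pen p (y * \<delta>) \<delta>"
    unfolding z using P_convex[OF \<delta>] t unfolding ereal_convex_def by simp
  moreover have "l (?z * \<delta>) \<le> (1 - t) * l (x * \<delta>) + t * l (y * \<delta>)"
    unfolding z using convex_onD[OF l_convex] t by simp
  ultimately show ?thesis
    unfolding pen_eq neg_log_post_def by (simp add: algebra_simps)
qed

section \<open>Two-sided bounds on the forward-backward envelope\<close>

text \<open>The point \<open>u = \<theta> * \<delta>\<close> in the minimum, combined with the tangent inequality for \<open>l\<close> at \<open>\<theta>\<close>.\<close>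
lemma h_gamma_le: "h_gamma \<gamma> l p \<theta> \<delta> \<le> ereal (1 / (2 * \<gamma>) * (norm (\<theta> - \<theta> * \<delta>))\<^sup>2 + H \<delta> \<theta>)"
proof -
  have "h_gamma \<gamma> l p \<theta> \<delta> \<le> ereal (l \<theta> + grad l \<theta> \<bullet> (\<theta> * \<delta> - \<theta>)) + pen p (\<theta> * \<delta>) \<delta>
      + ereal (1 / (2 * \<gamma>) * (norm (\<theta> * \<delta> - \<theta>))\<^sup>2)"
    unfolding h_gamma_def by (rule INF_lower) simp
  also have "\<dots> \<le> ereal (1 / (2 * \<gamma>) * (norm (\<theta> - \<theta> * \<delta>))\<^sup>2 + H \<delta> \<theta>)"
    using l_tangent[of \<theta> "\<theta> * \<delta>"] by (simp add: pen_sparse neg_log_post_def norm_minus_commute)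
  finally show ?thesis .
qed

text \<open>For sparse \<open>u\<close>, put \<open>v = u - \<theta> * \<delta>\<close>. The penalty at \<open>u\<close> is at least its affine minorant at
  \<open>\<theta> * \<delta>\<close>, and \<open>\<parallel>u - \<theta>\<parallel>\<^sup>2\<close> splits orthogonally into \<open>\<parallel>v\<parallel>\<^sup>2 + \<parallel>\<theta> - \<theta> * \<delta>\<parallel>\<^sup>2\<close>. What depends on \<open>v\<close>
  is a quadratic with minimum \<open>- \<gamma> / 2 \<parallel>G\<parallel>\<^sup>2\<close>, where \<open>G\<close> is the restriction to the model of the
  gradient plus the sub-gradient. The tangent inequality for \<open>l\<close> at \<open>\<theta> * \<delta>\<close> supplies the
  inner product in \<open>r_gamma\<close>.\<close>
lemma h_gamma_ge:
  assumes \<delta>: "\<delta> \<in> Delta"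
  shows "ereal (1 / (2 * \<gamma>) * (norm (\<theta> - \<theta> * \<delta>))\<^sup>2 + H \<delta> \<theta> - r_gamma \<gamma> l g \<delta> \<theta>) \<le> h_gamma \<gamma> l p \<theta> \<delta>"
  unfolding h_gamma_def
proof (rule INF_greatest)
  fix u :: "real ^ 'n"
  let ?t = "\<theta> * \<delta>"
  let ?g = "g ?t \<delta>"
  let ?G = "\<delta> * grad l \<theta> + \<delta> * ?g"
  let ?v = "u - ?t"
  let ?F = "ereal (l \<theta> + grad l \<theta> \<bullet> (u - \<theta>)) + pen p u \<delta> + ereal (1 / (2 * \<gamma>) * (norm (u - \<theta>))\<^sup>2)"
  show "ereal (1 / (2 * \<gamma>) * (norm (\<theta> - ?t))\<^sup>2 + H \<delta> \<theta> - r_gamma \<gamma> l g \<delta> \<theta>) \<le> ?F"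
  proof (cases "u \<in> R_sparse \<delta>")
    case False
    then show ?thesis by (simp add: pen_def)
  next
    case True
    define P where "P = - (\<Sum>j | \<delta> $ j = 1. ln (p (u $ j)))"
    define Q where "Q = - (\<Sum>j | \<delta> $ j = 1. ln (p (\<theta> $ j)))"
    have penu: "pen p u \<delta> = ereal P" using True by (simp add: pen_sparse P_def)
    have pent: "pen p ?t \<delta> = ereal Q" by (simp add: pen_sparse Q_def)
    have "pen p ?t \<delta> + ereal (?g \<bullet> ?v) \<le> pen p u \<delta>"
      using P_subgradient[OF \<delta>, of ?t] by (simp add: is_subgradient_def)
    then have sub: "Q + ?g \<bullet> ?v \<le> P" by (simp add: penu pent)
    have v: "?v \<in> R_sparse \<delta>" using True by (simp add: R_sparse_def)
    have orth: "?v \<bullet> (\<theta> - ?t) = 0" by (rule inner_sparse_complement[OF v \<delta>])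
    have "(norm (u - \<theta>))\<^sup>2 = (norm ?v)\<^sup>2 + (norm (\<theta> - ?t))\<^sup>2"
    proof -
      have "u - \<theta> = ?v - (\<theta> - ?t)" by simp
      then show ?thesis
        using orth unfolding power2_norm_eq_inner
        by (simp only: inner_diff_left inner_diff_right inner_commute)
    qed
    then have nrm: "1 / (2 * \<gamma>) * (norm (u - \<theta>))\<^sup>2
      = 1 / (2 * \<gamma>) * (norm ?v)\<^sup>2 + 1 / (2 * \<gamma>) * (norm (\<theta> - ?t))\<^sup>2"
      by (simp only: distrib_left)
    have G: "grad l \<theta> \<bullet> ?v + ?g \<bullet> ?v = ?G \<bullet> ?v"
      using inner_sparse[OF v \<delta>] by (simp add: inner_add_left)
    have "- (\<gamma> / 2 * (norm ?G)\<^sup>2) \<le> ?G \<bullet> ?v + 1 / (2 * \<gamma>) * (norm ?v)\<^sup>2"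
      by (rule norm_sq_lower[OF gamma_pos])
    moreover have "l ?t + grad l ?t \<bullet> (\<theta> - ?t) \<le> l \<theta>" by (rule l_tangent)
    moreover have "grad l \<theta> \<bullet> (u - \<theta>) = grad l \<theta> \<bullet> ?v - grad l \<theta> \<bullet> (\<theta> - ?t)"
      by (simp add: inner_diff_right)
    ultimately have "1 / (2 * \<gamma>) * (norm (\<theta> - ?t))\<^sup>2 + (l ?t + Q)
        - ((grad l \<theta> - grad l ?t) \<bullet> (\<theta> - ?t) + \<gamma> / 2 * (norm ?G)\<^sup>2)
      \<le> l \<theta> + grad l \<theta> \<bullet> (u - \<theta>) + P + 1 / (2 * \<gamma>) * (norm (u - \<theta>))\<^sup>2"
      using sub G nrm unfolding inner_diff_left[of "grad l \<theta>"] by linarith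
    then show ?thesis
      by (simp add: penu r_gamma_def neg_log_post_def Q_def)
  qed
qed

text \<open>The logarithm, up to an additive constant, of the density of the approximation with respect to the
  intermediate measure.\<close>
definition log_ratio :: "real ^ 'n \<Rightarrow> real ^ 'n \<Rightarrow> real" where
  "log_ratio \<delta> \<theta> = 1 / (2 * \<gamma>) * (norm (\<theta> - \<theta> * \<delta>))\<^sup>2 + H \<delta> \<theta> - real_of_ereal (h_gamma \<gamma> l p \<theta> \<delta>)"

lemma h_gamma_eq:
  assumes \<delta>: "\<delta> \<in> Delta"
  shows "h_gamma \<gamma> l p \<theta> \<delta> = ereal (1 / (2 * \<gamma>) * (norm (\<theta> - \<theta> * \<delta>))\<^sup>2 + H \<delta> \<theta> - log_ratio \<delta> \<theta>)"
  using h_gamma_le[of \<theta> \<delta>] h_gamma_ge[OF \<delta>, of \<theta>]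
  by (cases "h_gamma \<gamma> l p \<theta> \<delta>") (auto simp: log_ratio_def)

lemma log_ratio_bounds:
  assumes \<delta>: "\<delta> \<in> Delta"
  shows "0 \<le> log_ratio \<delta> \<theta>" "log_ratio \<delta> \<theta> \<le> r_gamma \<gamma> l g \<delta> \<theta>"
  using h_gamma_le[of \<theta> \<delta>] h_gamma_ge[OF \<delta>, of \<theta>] by (simp_all add: h_gamma_eq[OF \<delta>])

text \<open>An infimum over uncountably many \<open>u\<close>; it is measurable because an infimum of continuous functions
  is upper semi-continuous.\<close>
lemma borel_h_gamma [measurable]: "(\<lambda>\<theta>. h_gamma \<gamma> l p \<theta> \<delta>) \<in> borel_measurable borel"
proof (rule borel_measurableI_less)
  fix y :: ereal
  let ?F = "\<lambda>u \<theta>. ereal (l \<theta> + grad l \<theta> \<bullet> (u - \<theta>)) + pen p u \<delta> + ereal (1 / (2 * \<gamma>) * (norm (u - \<theta>))\<^sup>2)"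
  have "open {\<theta>. ?F u \<theta> < y}" for u
  proof (cases "pen p u \<delta>")
    case (real b)
    let ?k = "\<lambda>\<theta>. l \<theta> + grad l \<theta> \<bullet> (u - \<theta>) + b + 1 / (2 * \<gamma>) * (norm (u - \<theta>))\<^sup>2"
    have "continuous_on UNIV ?k"
      by (intro continuous_intros continuous_l continuous_grad)
    then have "open {\<theta>. ?k \<theta> < r}" for r
      by (rule open_Collect_less[OF _ continuous_on_const])
    then show ?thesis using real by (cases y) auto
  qed (auto simp: pen_def split: if_splits)
  then have "open (\<Union>u. {\<theta>. ?F u \<theta> < y})" by blast
  also have "(\<Union>u. {\<theta>. ?F u \<theta> < y}) = {\<theta> \<in> space borel. h_gamma \<gamma> l p \<theta> \<delta> < y}"
    by (auto simp: h_gamma_def INF_less_iff)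
  finally show "{\<theta> \<in> space borel. h_gamma \<gamma> l p \<theta> \<delta> < y} \<in> sets borel" by simp
qed

lemma borel_log_ratio [measurable]: "log_ratio \<delta> \<in> borel_measurable borel"
  unfolding log_ratio_def by measurable

section \<open>Integrals of tempered posterior densities\<close>

abbreviation "model_evidence \<delta> \<equiv> \<integral>\<^sup>+\<theta>. ennreal (exp (- H \<delta> \<theta>)) \<partial>mu \<delta>"

text \<open>A lower bound for \<open>l\<close> leaves the product of the prior densities, which integrates to \<open>1\<close>
  against \<open>mu \<delta>\<close>.\<close>
lemma model_evidence_finite:
  assumes \<delta>: "\<delta> \<in> Delta"
  shows "model_evidence \<delta> \<noteq> \<infinity>"
proof -
  obtain m where m: "\<And>\<theta>. m \<le> l \<theta>" using l_bounded_below by blast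
  have "model_evidence \<delta> \<le> (\<integral>\<^sup>+\<theta>. ennreal (exp (- m)) * (\<Prod>j | \<delta> $ j = 1. ennreal (p (\<theta> $ j))) \<partial>mu \<delta>)"
  proof (rule nn_integral_mono)
    fix \<theta> :: "real ^ 'n"
    have "exp (- H \<delta> \<theta>) \<le> exp (- m) * (\<Prod>j | \<delta> $ j = 1. p (\<theta> $ j))"
      unfolding exp_H using m p_pos by (intro mult_right_mono prod_nonneg) (auto intro: less_imp_le)
    then show "ennreal (exp (- H \<delta> \<theta>)) \<le> ennreal (exp (- m)) * (\<Prod>j | \<delta> $ j = 1. ennreal (p (\<theta> $ j)))"
      using p_pos by (simp add: prod_ennreal less_imp_le ennreal_mult'[symmetric] ennreal_leI)
  qed
  also have "\<dots> = ennreal (exp (- m)) * (\<integral>\<^sup>+\<theta>. (\<Prod>j | \<delta> $ j = 1. ennreal (p (\<theta> $ j))) \<partial>mu \<delta>)"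
    by (rule nn_integral_cmult) measurable
  also have "\<dots> = ennreal (exp (- m))"
    by (subst nn_integral_mu_prod[OF \<delta> _ p_int]) simp_all
  finally show ?thesis by (auto simp: top_unique)
qed

lemma model_evidence_pos:
  assumes \<delta>: "\<delta> \<in> Delta"
  shows "model_evidence \<delta> \<noteq> 0"
proof
  assume "model_evidence \<delta> = 0"
  then have "(\<integral>\<^sup>+\<theta>. ennreal (orth_gauss \<gamma> \<delta> \<theta>) * ennreal (exp (- H \<delta> (\<theta> * \<delta>))) \<partial>lborel) = 0"
    by (subst nn_integral_orth_gauss[OF gamma_pos \<delta>]) measurable
  then have "AE \<theta> in lborel. ennreal (orth_gauss \<gamma> \<delta> \<theta>) * ennreal (exp (- H \<delta> (\<theta> * \<delta>))) = 0"
    by (subst (asm) nn_integral_0_iff_AE) measurable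
  moreover have "ennreal (orth_gauss \<gamma> \<delta> \<theta>) * ennreal (exp (- H \<delta> (\<theta> * \<delta>))) \<noteq> 0" for \<theta>
  proof -
    have "0 < orth_gauss \<gamma> \<delta> \<theta>"
      using gamma_pos by (simp add: orth_gauss_def)
    then show ?thesis by (simp add: ennreal_eq_0_iff not_le)
  qed
  ultimately have "AE \<theta> in (lborel :: (real ^ 'n) measure). False" by simp
  then show False
    using AE_iff_null_sets[of UNIV "lborel :: (real ^ 'n) measure"] emeasure_lborel_UNIV by (auto simp: null_sets_def)
qed

text \<open>Convexity along \<open>\<theta> \<mapsto> (1 - t) \<theta> + t \<theta>0\<close> gives
  \<open>- (1 - t) H(\<theta>) \<le> t H(\<theta>0) - H((1 - t) \<theta> + t \<theta>0)\<close>. Integrating the exponential and undoing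
  the contraction by a change of variables produces the Jacobian \<open>(1 - t)\<close> to the power
  \<open>- norm0 \<delta>\<close>, which is at most \<open>exp (2 t norm0 \<delta>)\<close>.\<close>
lemma tempered_integral_le:
  assumes \<delta>: "\<delta> \<in> Delta" and t: "0 \<le> t" "t \<le> 3 / 4"
  shows "(\<integral>\<^sup>+\<theta>. ennreal (exp (- ((1 - t) * H \<delta> \<theta>))) \<partial>mu \<delta>)
    \<le> ennreal (exp (2 * t * norm0 \<delta> + t * H \<delta> \<theta>0)) * model_evidence \<delta>"
proof -
  let ?a = "t *\<^sub>R (\<theta>0 * \<delta>)" and ?k = "norm0 \<delta>"
  let ?X = "\<integral>\<^sup>+\<theta>. ennreal (exp (- H \<delta> ((1 - t) *\<^sub>R \<theta> + ?a))) \<partial>mu \<delta>"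
  have t1: "0 < 1 - t" using t by simp
  have X: "ennreal (1 - t) ^ ?k * ?X = model_evidence \<delta>"
    by (rule nn_integral_mu_affine[OF \<delta> t1]) (simp add: R_sparse_def, measurable)
  have "1 \<le> (exp (2 * t) * (1 - t)) ^ ?k"
    by (rule one_le_power[OF one_le_exp_mult[OF t]])
  then have "1 \<le> ennreal (exp (2 * t * ?k)) * ennreal (1 - t) ^ ?k"
    using t1 by (simp add: ennreal_power ennreal_mult'[symmetric] power_mult_distrib
        exp_of_nat_mult[symmetric] mult_ac)
  from mult_right_mono[OF this, of ?X]
  have X_le: "?X \<le> ennreal (exp (2 * t * ?k)) * model_evidence \<delta>"
    unfolding X[symmetric] by (simp add: mult.assoc)
  have "(\<integral>\<^sup>+\<theta>. ennreal (exp (- ((1 - t) * H \<delta> \<theta>))) \<partial>mu \<delta>)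
    \<le> (\<integral>\<^sup>+\<theta>. ennreal (exp (t * H \<delta> \<theta>0)) * ennreal (exp (- H \<delta> ((1 - t) *\<^sub>R \<theta> + ?a))) \<partial>mu \<delta>)"
  proof (rule nn_integral_mono)
    fix \<theta> :: "real ^ 'n"
    have "H \<delta> ((1 - t) *\<^sub>R \<theta> + ?a) \<le> (1 - t) * H \<delta> \<theta> + t * H \<delta> \<theta>0"
      using H_convex[OF \<delta>, of t \<theta> "\<theta>0 * \<delta>"] t by (simp add: neg_log_post_times[OF \<delta>])
    then show "ennreal (exp (- ((1 - t) * H \<delta> \<theta>)))
      \<le> ennreal (exp (t * H \<delta> \<theta>0)) * ennreal (exp (- H \<delta> ((1 - t) *\<^sub>R \<theta> + ?a)))"
      by (simp add: ennreal_mult'[symmetric] exp_add[symmetric])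
  qed
  also have "\<dots> = ennreal (exp (t * H \<delta> \<theta>0)) * ?X"
    by (rule nn_integral_cmult) measurable
  also have "\<dots> \<le> ennreal (exp (t * H \<delta> \<theta>0)) * (ennreal (exp (2 * t * ?k)) * model_evidence \<delta>)"
    by (rule mult_left_mono[OF X_le]) simp
  also have "\<dots> = ennreal (exp (2 * t * ?k + t * H \<delta> \<theta>0)) * model_evidence \<delta>"
    by (simp add: exp_add ennreal_mult' mult_ac)
  finally show ?thesis .
qed

section \<open>The intermediate measure\<close>

abbreviation tilde_density :: "real ^ 'n \<Rightarrow> real ^ 'n \<Rightarrow> real" where
  "tilde_density \<delta> \<theta> \<equiv> w \<delta> * orth_gauss \<gamma> \<delta> \<theta> * exp (- H \<delta> \<theta>)"

definition tilde_unnormalized :: "((real ^ 'n) \<times> (real ^ 'n)) measure" where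
  "tilde_unnormalized = joint_measure (\<lambda>\<delta>. density lborel (\<lambda>\<theta>. ennreal (tilde_density \<delta> \<theta>)))"

definition tilde_measure :: "((real ^ 'n) \<times> (real ^ 'n)) measure" where
  "tilde_measure = normalize_measure tilde_unnormalized"

lemma sets_tilde [simp, measurable_cong]: "sets tilde_unnormalized = sets model_algebra" "sets tilde_measure = sets model_algebra"
  by (simp_all add: tilde_unnormalized_def tilde_measure_def)

lemma space_tilde [simp]: "space tilde_unnormalized = Delta \<times> UNIV" "space tilde_measure = Delta \<times> UNIV"
  by (simp_all add: tilde_unnormalized_def tilde_measure_def)

lemma posterior_tilde_eq: "posterior_tilde \<gamma> l w p = tilde_measure"
proof -
  have "ennreal (w \<delta> * (1 / (2 * pi * \<gamma>)) powr ((real CARD('n) - real (norm0 \<delta>)) / 2) *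
         exp (- (1 / (2 * \<gamma>)) * (norm (\<theta> - \<theta> * \<delta>))\<^sup>2)) * eexp (- h_post l p (\<theta> * \<delta>) \<delta>)
      = ennreal (tilde_density \<delta> \<theta>)" for \<delta> \<theta> :: "real ^ 'n"
    by (simp add: h_post_times orth_gauss_def ennreal_mult''[symmetric] mult.assoc)
  then show ?thesis
    unfolding posterior_tilde_def tilde_measure_def tilde_unnormalized_def by simp
qed

lemma tilde_density_nonneg: "\<delta> \<in> Delta \<Longrightarrow> 0 \<le> tilde_density \<delta> \<theta>"
  by (simp add: w_nonneg)

lemma nn_integral_tilde_unnormalized:
  assumes F: "F \<in> borel_measurable model_algebra"
  shows "(\<integral>\<^sup>+x. F x \<partial>tilde_unnormalized) = (\<Sum>\<delta>\<in>Delta. \<integral>\<^sup>+\<theta>. ennreal (tilde_density \<delta> \<theta>) * F (\<delta>, \<theta>) \<partial>lborel)"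
  unfolding tilde_unnormalized_def
proof (subst nn_integral_joint_measure[OF _ F], simp, rule sum.cong[OF refl])
  fix \<delta> :: "real ^ 'n" assume \<delta>: "\<delta> \<in> Delta"
  note measurable_Pair_Delta[OF \<delta> F, measurable]
  show "(\<integral>\<^sup>+\<theta>. F (\<delta>, \<theta>) \<partial>density lborel (\<lambda>\<theta>. ennreal (tilde_density \<delta> \<theta>)))
    = (\<integral>\<^sup>+\<theta>. ennreal (tilde_density \<delta> \<theta>) * F (\<delta>, \<theta>) \<partial>lborel)"
    by (rule nn_integral_density) measurable
qed

lemma borel_model_algebra:
  assumes "\<And>\<delta>. \<delta> \<in> Delta \<Longrightarrow> F \<delta> \<in> measurable borel N"
  shows "(\<lambda>x. F (fst x) (snd x)) \<in> measurable model_algebra N"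
  by (rule measurable_pair_measure_countable1) (auto intro: countable_finite assms)

abbreviation "evidence \<equiv> \<Sum>\<delta>\<in>Delta. ennreal (w \<delta>) * model_evidence \<delta>"

text \<open>The Gaussian factor integrates to \<open>1\<close>, so the intermediate measure has the same normalizing
  constant as the posterior.\<close>
lemma emeasure_tilde_unnormalized: "emeasure tilde_unnormalized (Delta \<times> UNIV) = evidence"
proof -
  have "emeasure tilde_unnormalized (Delta \<times> UNIV) = (\<integral>\<^sup>+x. 1 \<partial>tilde_unnormalized)"
    by simp
  also have "\<dots> = (\<Sum>\<delta>\<in>Delta. \<integral>\<^sup>+\<theta>. ennreal (tilde_density \<delta> \<theta>) \<partial>lborel)"
    by (subst nn_integral_tilde_unnormalized) simp_all
  also have "\<dots> = evidence"
  proof (rule sum.cong[OF refl])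
    fix \<delta> :: "real ^ 'n" assume \<delta>: "\<delta> \<in> Delta"
    have "(\<integral>\<^sup>+\<theta>. ennreal (tilde_density \<delta> \<theta>) \<partial>lborel)
      = (\<integral>\<^sup>+\<theta>. ennreal (w \<delta>) * (ennreal (orth_gauss \<gamma> \<delta> \<theta>) * ennreal (exp (- H \<delta> (\<theta> * \<delta>)))) \<partial>lborel)"
      using w_nonneg[OF \<delta>] by (simp add: neg_log_post_times[OF \<delta>] ennreal_mult mult.assoc)
    also have "\<dots> = ennreal (w \<delta>) * (\<integral>\<^sup>+\<theta>. ennreal (orth_gauss \<gamma> \<delta> \<theta>) * ennreal (exp (- H \<delta> (\<theta> * \<delta>))) \<partial>lborel)"
      by (rule nn_integral_cmult) measurable
    also have "\<dots> = ennreal (w \<delta>) * model_evidence \<delta>"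
      by (subst nn_integral_orth_gauss[OF gamma_pos \<delta>]) simp_all
    finally show "(\<integral>\<^sup>+\<theta>. ennreal (tilde_density \<delta> \<theta>) \<partial>lborel) = ennreal (w \<delta>) * model_evidence \<delta>" .
  qed
  finally show ?thesis .
qed

lemma evidence_finite: "evidence \<noteq> \<infinity>"
  using model_evidence_finite by (auto simp: ennreal_mult_eq_top_iff)

lemma evidence_pos: "evidence \<noteq> 0"
proof
  assume "evidence = 0"
  then have "\<And>\<delta>. \<delta> \<in> Delta \<Longrightarrow> w \<delta> = 0"
    using model_evidence_pos w_nonneg by (force simp: ennreal_eq_0_iff)
  then show False using w_sum by simp
qed

lemma inverse_evidence: "inverse evidence * evidence = 1"
  using evidence_pos evidence_finite ennreal_divide_self[of evidence]
  by (simp add: divide_ennreal_def mult.commute top.not_eq_extremum)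

lemma prob_space_tilde: "prob_space tilde_measure"
  unfolding tilde_measure_def
  by (rule prob_space_normalize_measure) (use evidence_pos evidence_finite in \<open>simp_all only: space_tilde emeasure_tilde_unnormalized, auto\<close>)

lemma nn_integral_tilde:
  assumes F: "F \<in> borel_measurable model_algebra"
  shows "(\<integral>\<^sup>+x. F x \<partial>tilde_measure) = inverse evidence * (\<Sum>\<delta>\<in>Delta. \<integral>\<^sup>+\<theta>. ennreal (tilde_density \<delta> \<theta>) * F (\<delta>, \<theta>) \<partial>lborel)"
  using F unfolding tilde_measure_def
  by (subst nn_integral_normalize_measure)
    (simp_all only: space_tilde emeasure_tilde_unnormalized nn_integral_tilde_unnormalized measurable_cong_sets[OF sets_tilde(1) refl])

text \<open>The intermediate measure is a mixture over the models with weights proportional to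
  \<open>w \<delta> * model_evidence \<delta>\<close>, so a bound for every model is inherited by the mixture.\<close>
lemma nn_integral_tilde_le:
  assumes F: "F \<in> borel_measurable model_algebra"
    and le: "\<And>\<delta>. \<delta> \<in> Delta \<Longrightarrow>
      (\<integral>\<^sup>+\<theta>. ennreal (tilde_density \<delta> \<theta>) * F (\<delta>, \<theta>) \<partial>lborel) \<le> B * (ennreal (w \<delta>) * model_evidence \<delta>)"
  shows "(\<integral>\<^sup>+x. F x \<partial>tilde_measure) \<le> B"
proof -
  have "(\<integral>\<^sup>+x. F x \<partial>tilde_measure) \<le> inverse evidence * (\<Sum>\<delta>\<in>Delta. B * (ennreal (w \<delta>) * model_evidence \<delta>))"
    unfolding nn_integral_tilde[OF F] by (intro mult_left_mono sum_mono le) simp_all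
  also have "\<dots> = B * (inverse evidence * evidence)"
    by (simp only: sum_distrib_left[symmetric] mult_ac)
  finally show ?thesis by (simp only: inverse_evidence mult_1_right)
qed

lemma second_moment_tilde:
  "(\<integral>\<^sup>+x. ennreal ((norm (snd x - snd x * fst x))\<^sup>2) \<partial>tilde_measure) \<le> ennreal (\<gamma> * real CARD('n))"
proof (rule nn_integral_tilde_le)
  show "(\<lambda>x. ennreal ((norm (snd x - snd x * fst x))\<^sup>2)) \<in> borel_measurable model_algebra"
    by (rule borel_model_algebra) measurable
next
  fix \<delta> :: "real ^ 'n" assume \<delta>: "\<delta> \<in> Delta"
  let ?J = "{j. \<delta> $ j = 0}"
  have "(\<integral>\<^sup>+\<theta>. ennreal (tilde_density \<delta> \<theta>) * ennreal ((norm (snd (\<delta>, \<theta>) - snd (\<delta>, \<theta>) * fst (\<delta>, \<theta>)))\<^sup>2) \<partial>lborel)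
    = (\<integral>\<^sup>+\<theta>. ennreal (orth_gauss \<gamma> \<delta> \<theta> * (norm (\<theta> - \<theta> * \<delta>))\<^sup>2) * (ennreal (w \<delta>) * ennreal (exp (- H \<delta> (\<theta> * \<delta>)))) \<partial>lborel)"
    using w_nonneg[OF \<delta>] by (simp add: neg_log_post_times[OF \<delta>] ennreal_mult[symmetric] mult_ac)
  also have "\<dots> = ennreal (\<gamma> * real (card ?J)) * (\<integral>\<^sup>+\<theta>. ennreal (w \<delta>) * ennreal (exp (- H \<delta> \<theta>)) \<partial>mu \<delta>)"
    by (rule nn_integral_orth_gauss_sq[OF gamma_pos \<delta>]) measurable
  also have "\<dots> = ennreal (\<gamma> * real (card ?J)) * (ennreal (w \<delta>) * model_evidence \<delta>)"
    by (subst nn_integral_cmult) simp_all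
  also have "\<dots> \<le> ennreal (\<gamma> * real CARD('n)) * (ennreal (w \<delta>) * model_evidence \<delta>)"
    using gamma_pos by (intro mult_right_mono ennreal_leI mult_left_mono) (auto intro: card_mono)
  finally show "(\<integral>\<^sup>+\<theta>. ennreal (tilde_density \<delta> \<theta>) * ennreal ((norm (snd (\<delta>, \<theta>) - snd (\<delta>, \<theta>) * fst (\<delta>, \<theta>)))\<^sup>2) \<partial>lborel)
    \<le> ennreal (\<gamma> * real CARD('n)) * (ennreal (w \<delta>) * model_evidence \<delta>)" .
qed

section \<open>The exponential moment of the error term\<close>

text \<open>The Lipschitz bound controls the inner product in \<open>r_gamma\<close>. For the squared norm, the gradient at
  \<open>\<theta>\<close> is compared with the one at \<open>\<theta> * \<delta>\<close>, and the inequality between the square of a sum of three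
  terms and three times the sum of their squares isolates the quantities bounded by hypothesis. The
  constant \<open>11/8\<close> is \<open>1 + (3/2) (1/4)\<close>, the second part coming from \<open>\<gamma> L1 \<le> 1/4\<close>.\<close>
lemma r_gamma_le:
  assumes \<delta>: "\<delta> \<in> Delta"
  shows "r_gamma \<gamma> l g \<delta> \<theta> \<le> 3 * \<gamma> / 2 * c \<delta> + 3 * \<gamma> * L2 * H \<delta> \<theta>
    + 11 / 8 * L1 * (norm (\<theta> - \<theta> * \<delta>))\<^sup>2"
proof -
  let ?t = "\<theta> * \<delta>"
  let ?a = "\<delta> * grad l ?t" and ?b = "\<delta> * g ?t \<delta>" and ?e = "\<delta> * (grad l \<theta> - grad l ?t)"
  define n where "n = norm (\<theta> - ?t)"
  have n: "0 \<le> n" by (simp add: n_def)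
  have gl: "norm (grad l \<theta> - grad l ?t) \<le> L1 * n"
    unfolding n_def by (rule grad_lipschitz)
  have "(grad l \<theta> - grad l ?t) \<bullet> (\<theta> - ?t) \<le> norm (grad l \<theta> - grad l ?t) * n"
    unfolding n_def by (rule norm_cauchy_schwarz)
  also have "\<dots> \<le> L1 * n * n" using gl n by (rule mult_right_mono)
  finally have 1: "(grad l \<theta> - grad l ?t) \<bullet> (\<theta> - ?t) \<le> L1 * n\<^sup>2" by (simp add: power2_eq_square mult.assoc)
  have "norm ?e \<le> norm (grad l \<theta> - grad l ?t)"
  proof (rule norm_le_componentwise_cart)
    fix j
    have "\<delta> $ j = 0 \<or> \<delta> $ j = 1" using \<delta> by (auto simp: Delta_def)
    then show "norm (?e $ j) \<le> norm ((grad l \<theta> - grad l ?t) $ j)" by auto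
  qed
  then have "(norm ?e)\<^sup>2 \<le> (L1 * n)\<^sup>2" using gl by (intro power_mono) auto
  then have e: "(norm ?e)\<^sup>2 \<le> L1\<^sup>2 * n\<^sup>2" by (simp add: power_mult_distrib)
  have a: "(norm ?a)\<^sup>2 \<le> 2 * L2 * l ?t" by (rule grad_bound[OF \<delta> R_sparse_times])
  have b: "(norm ?b)\<^sup>2 \<le> c \<delta> + 2 * L2 * (H \<delta> \<theta> - l ?t)"
  proof -
    have "pen p ?t \<delta> = ereal (H \<delta> \<theta> - l ?t)"
      by (simp add: pen_sparse neg_log_post_def)
    then show ?thesis using subgrad_bound[OF \<delta> R_sparse_times, of \<theta>] by simp
  qed
  have "\<delta> * grad l \<theta> + \<delta> * g ?t \<delta> = ?a + ?b + ?e"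
    by (simp add: vec_eq_iff algebra_simps)
  then have "(norm (\<delta> * grad l \<theta> + \<delta> * g ?t \<delta>))\<^sup>2 \<le> 3 * ((norm ?a)\<^sup>2 + (norm ?b)\<^sup>2 + (norm ?e)\<^sup>2)"
    by (simp only: norm_sq_add3_le)
  also have "\<dots> \<le> 3 * (c \<delta> + 2 * L2 * H \<delta> \<theta> + L1\<^sup>2 * n\<^sup>2)"
    using a b e by (simp add: algebra_simps)
  finally have "\<gamma> / 2 * (norm (\<delta> * grad l \<theta> + \<delta> * g ?t \<delta>))\<^sup>2
    \<le> \<gamma> / 2 * (3 * (c \<delta> + 2 * L2 * H \<delta> \<theta> + L1\<^sup>2 * n\<^sup>2))"
    using gamma_pos by (intro mult_left_mono) auto
  also have "\<dots> = 3 * \<gamma> / 2 * c \<delta> + 3 * \<gamma> * L2 * H \<delta> \<theta> + 3 / 2 * (\<gamma> * L1) * (L1 * n\<^sup>2)"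
    by (simp add: field_simps power2_eq_square)
  also have "3 / 2 * (\<gamma> * L1) * (L1 * n\<^sup>2) \<le> 3 / 8 * (L1 * n\<^sup>2)"
  proof (rule mult_right_mono)
    show "3 / 2 * (\<gamma> * L1) \<le> 3 / 8" using gamma_L(1) by linarith
  qed (use L_nonneg in simp)
  finally show ?thesis
    using 1 unfolding r_gamma_def n_def[symmetric] by simp
qed

text \<open>Collects the Gaussian exponential moment, the tempered integral and the constant \<open>c \<delta>\<close>. The point
  \<open>\<theta>0\<close> may depend on the model; a real upper bound \<open>\<rho>\<close> for the values \<open>H \<delta> \<theta>0\<close> stands in for
  \<open>R_const\<close>, an infimum that need not be attained. The possibly
  non-measurable \<open>r_gamma\<close> is replaced by a measurable majorant before any integral is computed.\<close>
lemma exp_r_integral_le: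
  assumes \<rho>: "\<And>\<delta>. \<delta> \<in> Delta \<Longrightarrow> \<exists>\<theta>0. H \<delta> \<theta>0 \<le> \<rho>"
    and M: "\<And>\<delta>. \<delta> \<in> Delta \<Longrightarrow> c \<delta> \<le> M"
  shows "(\<integral>\<^sup>+x. ennreal (exp (r_gamma \<gamma> l g (fst x) (snd x))) \<partial>tilde_measure)
    \<le> ennreal (exp (3 * \<gamma> * (1 / 2 * M + real CARD('n) * (L1 + 2 * L2) + L2 * \<rho>)))" (is "_ \<le> ?B")
proof -
  define t where "t = 3 * \<gamma> * L2"
  define a where "a = 11 / 8 * L1"
  let ?F = "\<lambda>\<delta> \<theta>. ennreal (exp (3 * \<gamma> / 2 * c \<delta> + t * H \<delta> \<theta> + a * (norm (\<theta> - \<theta> * \<delta>))\<^sup>2))"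
  have "t = 3 * (\<gamma> * L2)" by (simp add: t_def)
  moreover have "0 \<le> \<gamma> * L2" using gamma_pos L_nonneg by simp
  ultimately have t: "0 \<le> t" "t \<le> 3 / 4"
    using gamma_L(2) by linarith+
  define x where "x = 2 * a * \<gamma>"
  have "x = 11 / 4 * (\<gamma> * L1)" by (simp add: x_def a_def)
  moreover have "0 \<le> \<gamma> * L1" using gamma_pos L_nonneg by simp
  ultimately have x: "0 \<le> x" "x \<le> 3 / 4" "x \<le> 3 * \<gamma> * L1"
    using gamma_L(1) by (simp_all add: mult.assoc)
  have "(\<integral>\<^sup>+x. ennreal (exp (r_gamma \<gamma> l g (fst x) (snd x))) \<partial>tilde_measure) \<le> (\<integral>\<^sup>+x. ?F (fst x) (snd x) \<partial>tilde_measure)"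
    using r_gamma_le by (intro nn_integral_mono) (auto simp: t_def a_def mult.assoc)
  also have "\<dots> \<le> ?B"
  proof (rule nn_integral_tilde_le)
    show "(\<lambda>x. ?F (fst x) (snd x)) \<in> borel_measurable model_algebra"
      by (rule borel_model_algebra) measurable
  next
    fix \<delta> :: "real ^ 'n" assume \<delta>: "\<delta> \<in> Delta"
    obtain \<theta>0 where \<theta>0: "H \<delta> \<theta>0 \<le> \<rho>" using \<rho>[OF \<delta>] by blast
    let ?m = "card {j. \<delta> $ j = 0}" and ?k = "norm0 \<delta>"
    let ?w = "w \<delta> * exp (3 * \<gamma> / 2 * c \<delta>)"
    have mk: "?m + ?k = CARD('n)" using codim_eq_card[of \<delta>] by linarith
    have wn: "0 \<le> ?w" using w_nonneg[OF \<delta>] by simp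
    \<comment> \<open>The Gaussian exponential moment obeys the same elementary inequality as the Jacobian, with \<open>x\<close> in the role of \<open>t\<close>.\<close>
    have gauss: "(1 / (1 - x)) powr (real ?m / 2) \<le> exp (x * ?m)"
    proof -
      have "1 / (1 - x) \<le> exp (2 * x)"
        using one_le_exp_mult[OF x(1,2)] x by (simp add: field_simps)
      then have "(1 / (1 - x)) powr (real ?m / 2) \<le> exp (2 * x) powr (real ?m / 2)"
        using x by (intro powr_mono2) auto
      moreover have "exp (2 * x) powr (real ?m / 2) = exp (x * ?m)" by (simp add: powr_def)
      ultimately show ?thesis by simp
    qed
    have "(\<integral>\<^sup>+\<theta>. ennreal (tilde_density \<delta> \<theta>) * ?F (fst (\<delta>, \<theta>)) (snd (\<delta>, \<theta>)) \<partial>lborel)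
      = (\<integral>\<^sup>+\<theta>. ennreal (orth_gauss \<gamma> \<delta> \<theta> * exp (a * (norm (\<theta> - \<theta> * \<delta>))\<^sup>2))
          * (ennreal ?w * ennreal (exp (- ((1 - t) * H \<delta> (\<theta> * \<delta>))))) \<partial>lborel)"
    proof (rule nn_integral_cong)
      fix \<theta> :: "real ^ 'n"
      have "tilde_density \<delta> \<theta> * exp (3 * \<gamma> / 2 * c \<delta> + t * H \<delta> \<theta> + a * (norm (\<theta> - \<theta> * \<delta>))\<^sup>2)
        = orth_gauss \<gamma> \<delta> \<theta> * exp (a * (norm (\<theta> - \<theta> * \<delta>))\<^sup>2) * (?w * exp (- ((1 - t) * H \<delta> \<theta>)))"
      proof -
        have 1: "exp (- ((1 - t) * H \<delta> \<theta>)) = exp (- H \<delta> \<theta>) * exp (t * H \<delta> \<theta>)"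
          unfolding exp_add[symmetric] by (simp add: algebra_simps)
        show ?thesis unfolding 1 exp_add by (simp only: mult_ac)
      qed
      then show "ennreal (tilde_density \<delta> \<theta>) * ?F (fst (\<delta>, \<theta>)) (snd (\<delta>, \<theta>))
        = ennreal (orth_gauss \<gamma> \<delta> \<theta> * exp (a * (norm (\<theta> - \<theta> * \<delta>))\<^sup>2))
          * (ennreal ?w * ennreal (exp (- ((1 - t) * H \<delta> (\<theta> * \<delta>)))))"
        using wn tilde_density_nonneg[OF \<delta>] by (simp add: neg_log_post_times[OF \<delta>] ennreal_mult[symmetric])
    qed
    also have "\<dots> = ennreal ((1 / (1 - x)) powr (real ?m / 2))
        * (\<integral>\<^sup>+\<theta>. ennreal ?w * ennreal (exp (- ((1 - t) * H \<delta> \<theta>))) \<partial>mu \<delta>)"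
      unfolding x_def
      by (rule nn_integral_orth_gauss_exp_sq[OF gamma_pos _ \<delta>]) (use x in \<open>simp add: x_def\<close>, measurable)
    also have "(\<integral>\<^sup>+\<theta>. ennreal ?w * ennreal (exp (- ((1 - t) * H \<delta> \<theta>))) \<partial>mu \<delta>)
      = ennreal ?w * (\<integral>\<^sup>+\<theta>. ennreal (exp (- ((1 - t) * H \<delta> \<theta>))) \<partial>mu \<delta>)"
      by (rule nn_integral_cmult) measurable
    also have "ennreal ((1 / (1 - x)) powr (real ?m / 2)) * \<dots>
      \<le> ennreal (exp (x * ?m)) * (ennreal ?w * (ennreal (exp (2 * t * ?k + t * H \<delta> \<theta>0)) * model_evidence \<delta>))"
      using w_nonneg[OF \<delta>] by (intro mult_mono ennreal_leI gauss tempered_integral_le[OF \<delta> t]) simp_all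
    also have "\<dots> = ennreal (exp (x * ?m + 3 * \<gamma> / 2 * c \<delta> + 2 * t * ?k + t * H \<delta> \<theta>0)) * (ennreal (w \<delta>) * model_evidence \<delta>)"
      using w_nonneg[OF \<delta>] by (simp add: exp_add ennreal_mult mult_ac)
    also have "\<dots> \<le> ?B * (ennreal (w \<delta>) * model_evidence \<delta>)"
    proof (intro mult_right_mono ennreal_leI)
      have "x * ?m \<le> 3 * \<gamma> * L1 * CARD('n)"
        using x gamma_pos L_nonneg mk by (intro mult_mono) auto
      moreover have "2 * t * ?k \<le> 2 * t * CARD('n)"
        using t mk by (intro mult_left_mono) auto
      moreover have "t * H \<delta> \<theta>0 \<le> t * \<rho>" using t \<theta>0 by (intro mult_left_mono) auto
      moreover have "3 * \<gamma> / 2 * c \<delta> \<le> 3 * \<gamma> / 2 * M"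
        using gamma_pos M[OF \<delta>] by (intro mult_left_mono) auto
      ultimately show "exp (x * ?m + 3 * \<gamma> / 2 * c \<delta> + 2 * t * ?k + t * H \<delta> \<theta>0)
        \<le> exp (3 * \<gamma> * (1 / 2 * M + real CARD('n) * (L1 + 2 * L2) + L2 * \<rho>))"
        by (simp add: t_def algebra_simps)
    qed simp
    finally show "(\<integral>\<^sup>+\<theta>. ennreal (tilde_density \<delta> \<theta>) * ?F (fst (\<delta>, \<theta>)) (snd (\<delta>, \<theta>)) \<partial>lborel)
      \<le> ?B * (ennreal (w \<delta>) * model_evidence \<delta>)" .
  qed
  finally show ?thesis .
qed

section \<open>Both posteriors in terms of the intermediate measure\<close>

abbreviation "smoothed_density \<delta> \<theta> \<equiv> ennreal (w \<delta> * (2 * pi * \<gamma>) powr (real (norm0 \<delta>) / 2)) *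
       eexp (- h_gamma \<gamma> l p \<theta> \<delta>)"

abbreviation "ratio \<equiv> \<lambda>x. ennreal (exp (log_ratio (fst x) (snd x)))"

definition Z :: ennreal where "Z = (\<integral>\<^sup>+x. ratio x \<partial>tilde_measure)"

text \<open>The powers of \<open>2 pi \<gamma>\<close> on both sides differ by a factor that is independent of the model, since
  \<open>norm0 \<delta> / 2 + (CARD('n) - norm0 \<delta>) / 2 = CARD('n) / 2\<close>.\<close>
lemma smoothed_density_eq:
  assumes \<delta>: "\<delta> \<in> Delta"
  shows "smoothed_density \<delta> \<theta> = ennreal (tilde_density \<delta> \<theta>) * (ennreal ((2 * pi * \<gamma>) powr (real CARD('n) / 2)) * ennreal (exp (log_ratio \<delta> \<theta>)))"
proof -
  let ?y = "2 * pi * \<gamma>" and ?d = "real CARD('n)" and ?k = "real (norm0 \<delta>)"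
  let ?q = "1 / (2 * \<gamma>) * (norm (\<theta> - \<theta> * \<delta>))\<^sup>2"
  have y: "0 < ?y" using gamma_pos by simp
  have "(1 / ?y) powr ((?d - ?k) / 2) * ?y powr (?d / 2) = ?y powr (- ((?d - ?k) / 2)) * ?y powr (?d / 2)"
    using y by (simp add: powr_minus powr_divide inverse_eq_divide)
  also have "\<dots> = ?y powr (?k / 2)"
    unfolding powr_add[symmetric] by (rule arg_cong[where f = "(powr) ?y"]) (simp add: field_simps)
  finally have pw: "(1 / ?y) powr ((?d - ?k) / 2) * ?y powr (?d / 2) = ?y powr (?k / 2)" .
  have "tilde_density \<delta> \<theta> * (?y powr (?d / 2) * exp (log_ratio \<delta> \<theta>))
    = w \<delta> * ((1 / ?y) powr ((?d - ?k) / 2) * ?y powr (?d / 2)) * (exp (- ?q) * exp (- H \<delta> \<theta>) * exp (log_ratio \<delta> \<theta>))"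
    unfolding orth_gauss_def by (simp add: mult_ac)
  also have "exp (- ?q) * exp (- H \<delta> \<theta>) * exp (log_ratio \<delta> \<theta>) = exp (- (?q + H \<delta> \<theta> - log_ratio \<delta> \<theta>))"
    unfolding exp_add[symmetric] by (simp add: algebra_simps)
  finally have eq: "tilde_density \<delta> \<theta> * (?y powr (?d / 2) * exp (log_ratio \<delta> \<theta>))
    = w \<delta> * ?y powr (?k / 2) * exp (- (?q + H \<delta> \<theta> - log_ratio \<delta> \<theta>))"
    unfolding pw .
  have "smoothed_density \<delta> \<theta> = ennreal (w \<delta> * ?y powr (?k / 2) * exp (- (?q + H \<delta> \<theta> - log_ratio \<delta> \<theta>)))"
    unfolding h_gamma_eq[OF \<delta>] uminus_ereal.simps eexp_ereal
    using w_nonneg[OF \<delta>] by (subst ennreal_mult) simp_all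
  also have "\<dots> = ennreal (tilde_density \<delta> \<theta>) * (ennreal ((2 * pi * \<gamma>) powr (real CARD('n) / 2)) * ennreal (exp (log_ratio \<delta> \<theta>)))"
    unfolding eq[symmetric] using w_nonneg[OF \<delta>] by (simp add: ennreal_mult)
  finally show ?thesis .
qed

lemma borel_ratio [measurable]: "ratio \<in> borel_measurable model_algebra"
  by (rule borel_model_algebra) measurable

lemma joint_smoothed_density: "joint_measure (\<lambda>\<delta>. density lborel (smoothed_density \<delta>)) = density tilde_unnormalized (\<lambda>x. ennreal ((2 * pi * \<gamma>) powr (real CARD('n) / 2)) * ratio x)"
proof -
  have "joint_measure (\<lambda>\<delta>. density lborel (smoothed_density \<delta>))
    = joint_measure (\<lambda>\<delta>. density (density lborel (\<lambda>\<theta>. ennreal (tilde_density \<delta> \<theta>))) (\<lambda>\<theta>. ennreal ((2 * pi * \<gamma>) powr (real CARD('n) / 2)) * ennreal (exp (log_ratio \<delta> \<theta>))))"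
  proof (rule joint_measure_cong)
    fix \<delta> :: "real ^ 'n" assume \<delta>: "\<delta> \<in> Delta"
    show "density lborel (smoothed_density \<delta>)
      = density (density lborel (\<lambda>\<theta>. ennreal (tilde_density \<delta> \<theta>))) (\<lambda>\<theta>. ennreal ((2 * pi * \<gamma>) powr (real CARD('n) / 2)) * ennreal (exp (log_ratio \<delta> \<theta>)))"
      unfolding smoothed_density_eq[OF \<delta>] by (rule density_density_eq[symmetric]) measurable
  qed
  also have "\<dots> = density tilde_unnormalized (\<lambda>x. ennreal ((2 * pi * \<gamma>) powr (real CARD('n) / 2)) * ratio x)"
    unfolding tilde_unnormalized_def by (rule joint_measure_density) simp_all
  finally show ?thesis .
qed

lemma posterior_gamma_eq:
  assumes "Z \<noteq> 0" "Z \<noteq> \<infinity>"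
  shows "posterior_gamma \<gamma> l w p = density tilde_measure (\<lambda>x. ratio x / Z)"
  unfolding posterior_gamma_def joint_smoothed_density tilde_measure_def
proof (rule normalize_measure_density)
  show "ratio \<in> borel_measurable tilde_unnormalized" by measurable
  show "emeasure tilde_unnormalized (space tilde_unnormalized) \<noteq> 0" "emeasure tilde_unnormalized (space tilde_unnormalized) \<noteq> \<infinity>"
    using evidence_pos evidence_finite unfolding space_tilde emeasure_tilde_unnormalized by auto
  show "(\<integral>\<^sup>+x. ratio x \<partial>normalize_measure tilde_unnormalized) = Z" by (simp add: Z_def tilde_measure_def)
  show "ennreal ((2 * pi * \<gamma>) powr (real CARD('n) / 2)) \<noteq> 0" using gamma_pos by (simp add: ennreal_eq_0_iff not_le)
qed (use assms in simp_all)

text \<open>The normalizing constant is, up to finite factors, the integral \<open>Z\<close> of the likelihood ratio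
  under the intermediate measure.\<close>
lemma normalizer_gamma_finite:
  assumes "Z \<noteq> \<infinity>"
  shows "normalizer_gamma \<gamma> l w p < \<infinity>"
proof -
  have "normalizer_gamma \<gamma> l w p = (\<Sum>\<delta>\<in>Delta. \<integral>\<^sup>+\<theta>. ennreal (tilde_density \<delta> \<theta>) * (ennreal ((2 * pi * \<gamma>) powr (real CARD('n) / 2)) * ratio (\<delta>, \<theta>)) \<partial>lborel)"
    unfolding normalizer_gamma_def
  proof (rule sum.cong[OF refl])
    fix \<delta> :: "real ^ 'n" assume \<delta>: "\<delta> \<in> Delta"
    have "(\<lambda>\<theta>. eexp (- h_gamma \<gamma> l p \<theta> \<delta>)) \<in> borel_measurable borel"
      unfolding h_gamma_eq[OF \<delta>] by simp
    then show "ennreal (w \<delta> * (2 * pi * \<gamma>) powr (real (norm0 \<delta>) / 2)) *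
        (\<integral>\<^sup>+\<theta>. eexp (- h_gamma \<gamma> l p \<theta> \<delta>) \<partial>lborel)
      = (\<integral>\<^sup>+\<theta>. ennreal (tilde_density \<delta> \<theta>) * (ennreal ((2 * pi * \<gamma>) powr (real CARD('n) / 2)) * ratio (\<delta>, \<theta>)) \<partial>lborel)"
      by (subst nn_integral_cmult[symmetric]) (simp_all add: smoothed_density_eq[OF \<delta>])
  qed
  also have "\<dots> = (\<integral>\<^sup>+x. ennreal ((2 * pi * \<gamma>) powr (real CARD('n) / 2)) * ratio x \<partial>tilde_unnormalized)"
    by (rule nn_integral_tilde_unnormalized[symmetric]) measurable
  also have "\<dots> = ennreal ((2 * pi * \<gamma>) powr (real CARD('n) / 2)) * (\<integral>\<^sup>+x. ratio x \<partial>tilde_unnormalized)"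
    by (rule nn_integral_cmult) measurable
  also have "(\<integral>\<^sup>+x. ratio x \<partial>tilde_unnormalized) = evidence * Z"
  proof -
    have "evidence * Z = (inverse evidence * evidence) * (\<integral>\<^sup>+x. ratio x \<partial>tilde_unnormalized)"
      unfolding Z_def nn_integral_tilde[OF borel_ratio] nn_integral_tilde_unnormalized[OF borel_ratio] by (simp only: mult_ac)
    then show ?thesis by (simp only: inverse_evidence mult_1)
  qed
  also have "ennreal ((2 * pi * \<gamma>) powr (real CARD('n) / 2)) * (evidence * Z) < \<infinity>"
    using assms evidence_finite by (simp only: infinity_ennreal_def ennreal_mult_less_top top.not_eq_extremum) simp
  finally show ?thesis .
qed

definition sparsify :: "(real ^ 'n) \<times> (real ^ 'n) \<Rightarrow> (real ^ 'n) \<times> (real ^ 'n)" where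
  "sparsify x = (fst x, snd x * fst x)"

lemma measurable_sparsify [measurable]: "sparsify \<in> measurable model_algebra model_algebra"
  unfolding sparsify_def
proof (rule measurable_Pair)
  show "(\<lambda>x. snd x * fst x) \<in> measurable model_algebra borel"
    by (rule borel_model_algebra[where F = "\<lambda>\<delta> \<theta>. \<theta> * \<delta>"]) measurable
qed measurable

lemma eexp_h_post:
  assumes \<delta>: "\<delta> \<in> Delta"
  shows "eexp (- h_post l p \<theta> \<delta>) = ennreal (exp (- H \<delta> \<theta>)) * indicator {\<theta>. norm (\<theta> - \<theta> * \<delta>) = 0} \<theta>"
proof (cases "\<theta> \<in> R_sparse \<delta>")
  case True
  then have "\<theta> * \<delta> = \<theta>" using R_sparse_iff[OF \<delta>] by simp
  then show ?thesis using h_post_times[of l p \<theta> \<delta>] by simp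
next
  case False
  then have "\<theta> * \<delta> \<noteq> \<theta>" using R_sparse_iff[OF \<delta>] by simp
  with False show ?thesis by (simp add: h_post_def pen_def eexp_def)
qed

text \<open>Setting the Gaussian coordinates to \<open>0\<close> undoes the smoothing.\<close>
lemma posterior_eq: "posterior l w p = distr tilde_measure model_algebra sparsify"
proof -
  let ?q = "\<lambda>\<delta> \<theta>. ennreal (w \<delta>) * eexp (- h_post l p \<theta> \<delta>)"
  let ?Q0 = "joint_measure (\<lambda>\<delta>. density (mu \<delta>) (?q \<delta>))"
  have e: "(\<lambda>\<theta>. eexp (- h_post l p \<theta> \<delta>)) \<in> borel_measurable borel" if "\<delta> \<in> Delta" for \<delta> :: "real ^ 'n"
    unfolding eexp_h_post[OF that] by measurable
  have "?Q0 = distr tilde_unnormalized model_algebra sparsify"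
  proof (rule measure_eqI)
    fix A assume "A \<in> sets ?Q0"
    then have A: "A \<in> sets model_algebra" by simp
    have "emeasure (distr tilde_unnormalized model_algebra sparsify) A = (\<integral>\<^sup>+x. indicator A x \<partial>distr tilde_unnormalized model_algebra sparsify)"
      using A by simp
    also have "\<dots> = (\<integral>\<^sup>+x. indicator A (sparsify x) \<partial>tilde_unnormalized)"
      using A by (intro nn_integral_distr) (simp_all add: measurable_cong_sets[OF sets_tilde(1) refl])
    also have "\<dots> = (\<Sum>\<delta>\<in>Delta. \<integral>\<^sup>+\<theta>. ennreal (tilde_density \<delta> \<theta>) * indicator A (sparsify (\<delta>, \<theta>)) \<partial>lborel)"
      by (rule nn_integral_tilde_unnormalized, rule measurable_compose[OF measurable_sparsify borel_measurable_indicator[OF A]])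
    also have "\<dots> = (\<Sum>\<delta>\<in>Delta. emeasure (density (mu \<delta>) (?q \<delta>)) (Pair \<delta> -` A))"
    proof (rule sum.cong[OF refl])
      fix \<delta> :: "real ^ 'n" assume \<delta>: "\<delta> \<in> Delta"
      note e[OF \<delta>, measurable]
      have qm [measurable]: "?q \<delta> \<in> borel_measurable borel" by measurable
      have A\<delta> [measurable]: "Pair \<delta> -` A \<in> sets borel" using sets_Pair1[OF A] by simp
      have "emeasure (density (mu \<delta>) (?q \<delta>)) (Pair \<delta> -` A)
        = (\<integral>\<^sup>+\<theta>. ?q \<delta> \<theta> * indicator (Pair \<delta> -` A) \<theta> \<partial>mu \<delta>)"
        using qm A\<delta> by (intro emeasure_density) (simp_all only: measurable_cong_sets[OF sets_mu refl] sets_mu)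
      also have "\<dots> = (\<integral>\<^sup>+\<theta>. ennreal (orth_gauss \<gamma> \<delta> \<theta>) *
          (?q \<delta> (\<theta> * \<delta>) * indicator (Pair \<delta> -` A) (\<theta> * \<delta>)) \<partial>lborel)"
        by (rule nn_integral_orth_gauss[OF gamma_pos \<delta>, symmetric]) measurable
      also have "\<dots> = (\<integral>\<^sup>+\<theta>. ennreal (tilde_density \<delta> \<theta>) * indicator A (sparsify (\<delta>, \<theta>)) \<partial>lborel)"
        using w_nonneg[OF \<delta>]
        by (intro nn_integral_cong) (simp add: h_post_times sparsify_def ennreal_mult indicator_def mult_ac)
      finally show "(\<integral>\<^sup>+\<theta>. ennreal (tilde_density \<delta> \<theta>) * indicator A (sparsify (\<delta>, \<theta>)) \<partial>lborel)
        = emeasure (density (mu \<delta>) (?q \<delta>)) (Pair \<delta> -` A)" by simp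
    qed
    also have "\<dots> = emeasure ?Q0 A"
      using A by (subst emeasure_joint_measure) simp_all
    finally show "emeasure ?Q0 A = emeasure (distr tilde_unnormalized model_algebra sparsify) A" by simp
  qed simp
  then show ?thesis
    unfolding posterior_def tilde_measure_def
    by (simp add: normalize_measure_distr measurable_cong_sets[OF sets_tilde(1) refl])
qed

section \<open>The approximation bound\<close>

abbreviation "r_moment \<equiv> \<integral>\<^sup>+x. ennreal (exp (r_gamma \<gamma> l g (fst x) (snd x))) \<partial>tilde_measure"

lemma Z_le_r_moment: "Z \<le> r_moment"
  unfolding Z_def by (rule nn_integral_mono) (auto intro!: ennreal_leI log_ratio_bounds)

lemma Z_ge_1: "1 \<le> Z"
proof -
  interpret prob_space tilde_measure by (rule prob_space_tilde)
  have "1 = (\<integral>\<^sup>+x. 1 \<partial>tilde_measure)" using emeasure_space_1 by simp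
  also have "\<dots> \<le> Z"
    unfolding Z_def using log_ratio_bounds(1) by (intro nn_integral_mono) auto
  finally show ?thesis .
qed

text \<open>The triangle inequality through the intermediate measure. Since \<open>log_ratio \<ge> 0\<close> and \<open>Z \<le> v\<close>,
  the density \<open>exp log_ratio / Z\<close> is at least \<open>1 / v\<close>.\<close>
lemma d_beta_posterior_le:
  assumes r_moment: "r_moment = ennreal v" "0 \<le> v"
  shows "d_beta model_dist (posterior_gamma \<gamma> l w p) (posterior l w p)
    \<le> ereal (sqrt (\<gamma> * real CARD('n)) + 2 * (1 - 1 / v))"
proof (rule d_beta_le)
  interpret T: prob_space tilde_measure by (rule prob_space_tilde)
  obtain \<zeta> where \<zeta>: "Z = ennreal \<zeta>" "0 \<le> \<zeta>"
    using Z_le_r_moment r_moment by (cases Z) (auto simp: top_unique)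
  have \<zeta>1: "1 \<le> \<zeta>" using Z_ge_1 unfolding \<zeta>(1) by simp
  have \<zeta>v: "\<zeta> \<le> v" using Z_le_r_moment r_moment unfolding \<zeta>(1) by simp
  have G: "posterior_gamma \<gamma> l w p = density tilde_measure (\<lambda>x. ennreal (exp (log_ratio (fst x) (snd x)) / \<zeta>))"
    using \<zeta>1 by (subst posterior_gamma_eq) (simp_all add: \<zeta> divide_ennreal)
  have Q: "posterior l w p = distr tilde_measure tilde_measure sparsify"
    unfolding posterior_eq by (rule distr_cong) simp_all
  show "space (posterior_gamma \<gamma> l w p) = Delta \<times> UNIV" by (simp add: G)
  show "space (posterior l w p) = Delta \<times> UNIV" by (simp add: Q)
  show "Delta \<times> UNIV \<noteq> {}" by simp
  show "0 \<le> model_dist x y" for x y :: "(real ^ 'n) \<times> (real ^ 'n)" by (simp add: model_dist_def)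
  fix f :: "(real ^ 'n) \<times> (real ^ 'n) \<Rightarrow> real"
  assume "f \<in> borel_measurable (posterior_gamma \<gamma> l w p)"
  then have f: "f \<in> borel_measurable tilde_measure" by (simp add: G)
  assume f1: "\<And>x. x \<in> Delta \<times> UNIV \<Longrightarrow> \<bar>f x\<bar> \<le> 1"
    and lip: "\<And>x y. x \<in> Delta \<times> UNIV \<Longrightarrow> y \<in> Delta \<times> UNIV \<Longrightarrow> \<bar>f x - f y\<bar> \<le> model_dist x y"
  have int1: "(\<integral>\<^sup>+x. ennreal (exp (log_ratio (fst x) (snd x)) / \<zeta>) \<partial>tilde_measure) = 1"
  proof -
    have "(\<integral>\<^sup>+x. ennreal (exp (log_ratio (fst x) (snd x)) / \<zeta>) \<partial>tilde_measure) = (\<integral>\<^sup>+x. ratio x / ennreal \<zeta> \<partial>tilde_measure)"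
      using \<zeta>1 by (simp add: divide_ennreal)
    also have "\<dots> = Z / ennreal \<zeta>"
      unfolding Z_def by (rule nn_integral_divide) measurable
    finally show ?thesis using \<zeta>1 by (simp add: \<zeta> divide_ennreal)
  qed
  have ratio_measurable: "(\<lambda>x. exp (log_ratio (fst x) (snd x)) / \<zeta>) \<in> borel_measurable tilde_measure"
    unfolding measurable_cong_sets[OF sets_tilde(2) refl] by (rule borel_model_algebra) measurable
  have int: "integrable tilde_measure (\<lambda>x. exp (log_ratio (fst x) (snd x)) / \<zeta>)"
    by (rule integrableI_nonneg) (use ratio_measurable \<zeta>1 int1 in auto)
  have TV: "\<bar>(\<integral>x. f x \<partial>posterior_gamma \<gamma> l w p) - (\<integral>x. f x \<partial>tilde_measure)\<bar> \<le> 2 * (1 - 1 / v)"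
    unfolding G
  proof (rule T.abs_integral_density_diff_le[OF int _ _ _ f])
    show "(\<integral>x. exp (log_ratio (fst x) (snd x)) / \<zeta> \<partial>tilde_measure) = 1"
      using ratio_measurable \<zeta>1 int1 by (subst integral_eq_nn_integral) auto
    fix x assume x: "x \<in> space tilde_measure"
    show "\<bar>f x\<bar> \<le> 1" using x f1 by simp
    show "1 / v \<le> exp (log_ratio (fst x) (snd x)) / \<zeta>"
      using \<zeta>1 \<zeta>v log_ratio_bounds(1)[of "fst x" "snd x"] x by (intro frac_le) auto
  qed (use r_moment in simp)
  have W: "\<bar>(\<integral>x. f x \<partial>tilde_measure) - (\<integral>x. f x \<partial>posterior l w p)\<bar> \<le> sqrt (\<gamma> * real CARD('n))"
    unfolding Q
  proof (rule T.abs_integral_distr_diff_le[OF _ f _ _ second_moment_tilde])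
    show "sparsify \<in> measurable tilde_measure tilde_measure" by measurable
    show "0 \<le> \<gamma> * real CARD('n)" using gamma_pos by simp
    fix x assume x: "x \<in> space tilde_measure"
    show "\<bar>f x\<bar> \<le> 1" using x f1 by simp
    have "\<bar>f x - f (sparsify x)\<bar> \<le> model_dist x (sparsify x)"
      using x by (intro lip) (auto simp: sparsify_def)
    then show "\<bar>f x - f (sparsify x)\<bar> \<le> norm (snd x - snd x * fst x)"
      by (simp add: model_dist_def sparsify_def norm0_def)
  qed
  show "\<bar>(\<integral>x. f x \<partial>posterior_gamma \<gamma> l w p) - (\<integral>x. f x \<partial>posterior l w p)\<bar>
    \<le> sqrt (\<gamma> * real CARD('n)) + 2 * (1 - 1 / v)"
    using TV W by linarith
qed

lemma R_const_eq: "R_const l p = (MAX \<delta>\<in>Delta. INF \<theta>. ereal (H \<delta> \<theta>))"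
  unfolding R_const_def h_post_times[unfolded h_post_def] ..

lemma R_const_le: "R_const l p \<le> (MAX \<delta>\<in>Delta. ereal (l 0) + pen p (0 :: real ^ 'n) \<delta>)"
  unfolding R_const_def
proof (rule Max.boundedI)
  fix b assume "b \<in> (\<lambda>\<delta>. INF \<theta>. ereal (l (\<theta> * \<delta>)) + pen p (\<theta> * \<delta>) \<delta>) ` Delta"
  then obtain \<delta> where \<delta>: "\<delta> \<in> Delta" and b: "b = (INF \<theta>. ereal (l (\<theta> * \<delta>)) + pen p (\<theta> * \<delta>) \<delta>)"
    by auto
  have "b \<le> ereal (l 0) + pen p (0 :: real ^ 'n) \<delta>"
    unfolding b by (rule INF_lower2[of 0]) (simp_all add: mult_zero_left)
  also have "\<dots> \<le> (MAX \<delta>\<in>Delta. ereal (l 0) + pen p (0 :: real ^ 'n) \<delta>)"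
    using \<delta> by (intro Max_ge finite_imageI finite_Delta imageI)
  finally show "b \<le> (MAX \<delta>\<in>Delta. ereal (l 0) + pen p (0 :: real ^ 'n) \<delta>)" .
qed simp_all

lemma exp_r_integral_le_R:
  assumes "R_const l p < ereal \<rho>"
  shows "r_moment \<le> ennreal (exp (3 * \<gamma> * (1 / 2 * (MAX \<delta>\<in>Delta. c \<delta>) + real CARD('n) * (L1 + 2 * L2) + L2 * \<rho>)))"
proof (rule exp_r_integral_le)
  fix \<delta> :: "real ^ 'n" assume \<delta>: "\<delta> \<in> Delta"
  then show "c \<delta> \<le> (MAX \<delta>\<in>Delta. c \<delta>)" by (intro Max_ge) auto
  have "(INF \<theta>. ereal (H \<delta> \<theta>)) \<le> R_const l p"
    unfolding R_const_eq using \<delta> by (intro Max_ge) auto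
  then have "(INF \<theta>. ereal (H \<delta> \<theta>)) < ereal \<rho>" using assms by (rule le_less_trans)
  then show "\<exists>\<theta>0. H \<delta> \<theta>0 \<le> \<rho>" unfolding INF_less_iff by (auto intro: less_imp_le)
qed

text \<open>The bound on \<open>varrho\<close> is first obtained with any real \<open>\<rho>\<close> above \<open>R_const\<close> in place of
  \<open>R_const\<close>, and then \<open>\<rho>\<close> decreases to it.\<close>
theorem posterior_gamma_approximation:
  "normalizer_gamma \<gamma> l w p < \<infinity>
    \<and> d_beta model_dist (posterior_gamma \<gamma> l w p) (posterior l w p)
        \<le> ereal (sqrt (\<gamma> * real CARD('n))) + 2 * (1 - enn2ereal (eexp (- varrho \<gamma> l w p g)))
    \<and> varrho \<gamma> l w p g
        \<le> ereal (3 * \<gamma>) * (ereal (1 / 2 * (MAX \<delta>\<in>Delta. c \<delta>) + real CARD('n) * (L1 + 2 * L2))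
          + ereal L2 * R_const l p)
    \<and> R_const l p \<le> (MAX \<delta>\<in>Delta. ereal (l 0) + pen p (0 :: real ^ 'n) \<delta>)"
proof -
  let ?A = "1 / 2 * (MAX \<delta>\<in>Delta. c \<delta>) + real CARD('n) * (L1 + 2 * L2)"
  have "R_const l p \<noteq> \<infinity>"
  proof -
    have "(MAX \<delta>\<in>Delta. ereal (l 0) + pen p (0 :: real ^ 'n) \<delta>)
      \<in> (\<lambda>\<delta>. ereal (l 0) + pen p (0 :: real ^ 'n) \<delta>) ` Delta"
      by (rule Max_in) simp_all
    then obtain \<delta> :: "real ^ 'n" where
      "(MAX \<delta>\<in>Delta. ereal (l 0) + pen p (0 :: real ^ 'n) \<delta>) = ereal (l 0) + pen p 0 \<delta>" by (rule imageE)
    also have "\<dots> \<noteq> \<infinity>" by (simp add: pen_def R_sparse_def)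
    finally have "(MAX \<delta>\<in>Delta. ereal (l 0) + pen p (0 :: real ^ 'n) \<delta>) \<noteq> \<infinity>" .
    then show ?thesis using R_const_le by (metis ereal_infty_less_eq(1))
  qed
  then obtain \<rho>0 where \<rho>0: "R_const l p < ereal \<rho>0"
    by (metis less_PInf_Ex_of_nat)
  obtain v where v: "r_moment = ennreal v" "0 \<le> v"
    using exp_r_integral_le_R[OF \<rho>0] by (cases r_moment) (auto simp: top_unique)
  have v1: "1 \<le> v" using order_trans[OF Z_ge_1 Z_le_r_moment] unfolding v(1) by simp
  have vr: "varrho \<gamma> l w p g = ereal (ln v)"
    using v1 unfolding varrho_def posterior_tilde_eq v(1) eln_def by simp
  have ln_le: "ln v \<le> 3 * \<gamma> * (?A + L2 * \<rho>)" if "R_const l p < ereal \<rho>" for \<rho>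
  proof -
    have "v \<le> exp (3 * \<gamma> * (?A + L2 * \<rho>))"
      using exp_r_integral_le_R[OF that] unfolding v(1) by (simp add: add.assoc)
    then have "ln v \<le> ln (exp (3 * \<gamma> * (?A + L2 * \<rho>)))"
      using v1 by (subst ln_le_cancel_iff) auto
    then show ?thesis by simp
  qed
  have "varrho \<gamma> l w p g \<le> ereal (3 * \<gamma>) * (ereal ?A + ereal L2 * R_const l p)"
  proof (cases "R_const l p")
    case (real R)
    have "ln v \<le> 3 * \<gamma> * (?A + L2 * R)"
    proof (rule field_le_epsilon)
      fix \<epsilon> :: real assume \<epsilon>: "0 < \<epsilon>"
      let ?\<eta> = "\<epsilon> / (3 * \<gamma> * L2 + 1)"
      have den: "0 < 3 * \<gamma> * L2 + 1" using gamma_pos L_nonneg by (simp add: add_nonneg_pos)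
      have "R_const l p < ereal (R + ?\<eta>)" using \<epsilon> den by (simp add: real)
      from ln_le[OF this] have "ln v \<le> 3 * \<gamma> * (?A + L2 * R) + 3 * \<gamma> * L2 * ?\<eta>"
        by (simp add: algebra_simps)
      also have "3 * \<gamma> * L2 * ?\<eta> \<le> \<epsilon>"
        using \<epsilon> den by (simp add: field_simps)
      finally show "ln v \<le> 3 * \<gamma> * (?A + L2 * R) + \<epsilon>" by simp
    qed
    then show ?thesis by (simp add: vr real)
  next
    case PInf
    with \<open>R_const l p \<noteq> \<infinity>\<close> show ?thesis by simp
  next
    case MInf
    have all: "ln v \<le> 3 * \<gamma> * (?A + L2 * \<rho>)" for \<rho> using ln_le by (simp add: MInf)
    have "L2 = 0"
    proof (rule ccontr)
      assume "L2 \<noteq> 0"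
      \<comment> \<open>If \<open>L2 > 0\<close>, a very negative \<open>\<rho>\<close> would make the upper bound for \<open>ln v\<close> negative.\<close>
      then have "3 * \<gamma> * (?A + L2 * ((- 1 / (3 * \<gamma>) - ?A) / L2)) = - 1"
        using gamma_pos by (simp add: field_simps)
      then have "ln v \<le> - 1" using all[of "(- 1 / (3 * \<gamma>) - ?A) / L2"] by simp
      moreover have "0 \<le> ln v" using v1 by simp
      ultimately show False by simp
    qed
    then show ?thesis using all[of 0] by (simp add: vr zero_ereal_def[symmetric])
  qed
  moreover have "eexp (- varrho \<gamma> l w p g) = ennreal (1 / v)"
    using v1 by (simp add: vr exp_minus inverse_eq_divide)
  then have "ereal (sqrt (\<gamma> * real CARD('n))) + 2 * (1 - enn2ereal (eexp (- varrho \<gamma> l w p g)))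
    = ereal (sqrt (\<gamma> * real CARD('n)) + 2 * (1 - 1 / v))"
    using v1 by (simp add: one_ereal_def numeral_eq_ereal)
  moreover have "Z \<noteq> \<infinity>" using Z_le_r_moment unfolding v(1) by (auto simp: top_unique)
  ultimately show ?thesis
    using d_beta_posterior_le[OF v] R_const_le normalizer_gamma_finite by simp
qed

end

theorem theorem8:
  fixes f :: "real ^ 'n \<Rightarrow> 'z \<Rightarrow> real" and z :: 'z
    and w :: "real ^ 'n \<Rightarrow> real"
    and p :: "real \<Rightarrow> real"
    and g :: "real ^ 'n \<Rightarrow> real ^ 'n \<Rightarrow> real ^ 'n"
    and c :: "real ^ 'n \<Rightarrow> real"
    and L1 L2 \<gamma> :: real
  assumes prior_delta: "\<forall>\<delta>\<in>Delta. 0 \<le> w \<delta>" "(\<Sum>\<delta>\<in>Delta. w \<delta>) = 1"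
    and prior_theta: "p \<in> borel_measurable borel" "\<forall>x. 0 < p x"
      "(\<integral>\<^sup>+x. ennreal (p x) \<partial>lborel) = 1"
    and lik_finite: "\<forall>\<theta>. 0 < f \<theta> z"
    and lik_convex: "convex_on UNIV (neg_log_lik f z)"
    and lik_C2: "twice_cont_diff (neg_log_lik f z)"
    and P_convex: "\<forall>\<delta>\<in>Delta. ereal_convex (\<lambda>\<theta> :: real ^ 'n. pen p \<theta> \<delta>)"
    and P_lsc: "\<forall>\<delta>\<in>Delta. lower_semicont (\<lambda>\<theta> :: real ^ 'n. pen p \<theta> \<delta>)"
    and P_proper: "\<forall>\<delta>\<in>Delta. \<exists>\<theta> :: real ^ 'n. pen p \<theta> \<delta> \<noteq> \<infinity>"
    and P_subgradient: "\<forall>\<delta>\<in>Delta. \<forall>\<theta>\<in>R_sparse \<delta>. is_subgradient (\<lambda>u. pen p u \<delta>) (g \<theta> \<delta>) \<theta>"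
    and L_nonneg: "0 \<le> L1" "0 \<le> L2"
    and grad_lipschitz: "\<forall>\<theta>1 \<theta>2. norm (grad (neg_log_lik f z) \<theta>1 - grad (neg_log_lik f z) \<theta>2)
      \<le> L1 * norm (\<theta>1 - \<theta>2)"
    and grad_bound: "\<forall>\<delta>\<in>Delta. \<forall>\<theta>\<in>R_sparse \<delta>.
      (norm (\<delta> * grad (neg_log_lik f z) \<theta>))\<^sup>2 \<le> 2 * L2 * neg_log_lik f z \<theta>"
    and subgrad_bound: "\<forall>\<delta>\<in>Delta. \<forall>\<theta>\<in>R_sparse \<delta>.
      ereal ((norm (\<delta> * g \<theta> \<delta>))\<^sup>2) \<le> ereal (c \<delta>) + ereal (2 * L2) * pen p \<theta> \<delta>"
    and gamma: "0 < \<gamma>" "4 * \<gamma> * max L1 L2 \<le> 1"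
  shows "normalizer_gamma \<gamma> (neg_log_lik f z) w p < \<infinity>
    \<and> d_beta model_dist (posterior_gamma \<gamma> (neg_log_lik f z) w p) (posterior (neg_log_lik f z) w p)
        \<le> ereal (sqrt (\<gamma> * real CARD('n)))
          + 2 * (1 - enn2ereal (eexp (- varrho \<gamma> (neg_log_lik f z) w p g)))
    \<and> varrho \<gamma> (neg_log_lik f z) w p g
        \<le> ereal (3 * \<gamma>) * (ereal (1 / 2 * (MAX \<delta>\<in>Delta. c \<delta>) + real CARD('n) * (L1 + 2 * L2))
          + ereal L2 * R_const (neg_log_lik f z) p)
    \<and> R_const (neg_log_lik f z) p
        \<le> (MAX \<delta>\<in>Delta. ereal (neg_log_lik f z 0) + pen p (0 :: real ^ 'n) \<delta>)"
proof (rule sparse_model.posterior_gamma_approximation, unfold_locales)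
  show "GDERIV (neg_log_lik f z) x :> grad (neg_log_lik f z) x" for x
    using lik_C2 unfolding twice_cont_diff_def by (auto intro: GDERIV_grad)
qed (use assms in auto)

end
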